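(* Let $M$ be a connected, compact complex manifold of complex dimension $n\ge2$ endowed with a Hermitian metric $\omega$ such that $S^{Ch}(\omega)=\Gamma(\{\omega\})<0$, and let $f_0$ be the eccentricity function of $\omega$. Suppose that $g\in C^{\infty}(M,\mathbb{R})$ is negative somewhere on $M$. Then $g$ is the Chern scalar curvature of a metric conformally equivalent to $\omega$ if there exists $\varphi\in Aut(M)$ such that $\int_M (g\circ\varphi)f_0\frac{\omega^n}{n!}<0$ and $c(g\circ\varphi)<\Gamma(\{\omega\})$.
   Context: Hermitian metrics $h$ on $M$ are identified with their fundamental $(1,1)$-forms $\omega=h(J\cdot,\cdot)$, written locally as $\omega=\sqrt{-1}\,\omega_{i\bar j}\,dz_i\wedge d\overline{z_j}$ with $\omega_{i\bar j}=h(\partial_{z_i},\partial_{\overline{z_j}})$. The Chern scalar curvature of $\omega$ is the function $S^{Ch}(\omega)=\mathrm{tr}_\omega Ric^{(1)}(\omega)=\omega^{i\bar j}\omega^{k\bar l}R_{i\bar jk\bar l}$, where $R_{i\bar jk\bar l}$ are the components of the curvature of the Chern connection and $Ric^{(1)}(\omega)=\sqrt{-1}\,\omega^{k\bar l}R_{i\bar jk\bar l}\,dz_i\wedge d\overline{z_j}$ is the first Chern-Ricci form (locally $-\sqrt{-1}\,\partial\bar\partial\log\det(\omega_{k\bar l})$). The Chern Laplacian is $\Delta_\omega^{Ch}u=2\sqrt{-1}\,\mathrm{tr}_\omega\bar\partial\partial u$, locally $-2\omega^{i\bar j}\frac{\partial^2u}{\partial z_i\partial\overline{z_j}}$, for $u\in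 C^\infty(M,\mathbb{R})$. Its formal $L^2$-adjoint $(\Delta_\omega^{Ch})^*$ with respect to the volume form $\frac{\omega^n}{n!}$ has one-dimensional kernel; the eccentricity function $f_0\in C^\infty(M,\mathbb{R})$ of $\omega$ is the unique element of $\ker((\Delta_\omega^{Ch})^* )$ with $\int_M f_0\frac{\omega^n}{n!}=Vol(M,\omega)=\int_M\frac{\omega^n}{n!}$; it is known that $f_0>0$. The conformal class of $\omega$ is $\{\omega\}=\{\exp(2u/n)\,\omega : u\in C^\infty(M,\mathbb{R})\}$. $Aut(M)$ is the group of biholomorphisms of $M$. A Hermitian metric $\omega_1$ is conformally equivalent to $\omega$ if there exists $\varphi\in Aut(M)$ with $\varphi^*\omega_1\in\{\omega\}$. A Hermitian metric $\eta$ is Gauduchon if $\partial\bar\partial\eta^{n-1}=0$. For $M$ compact with $n\ge2$, each conformal class contains a unique Gauduchon metric $\eta$ of volume $\int_M\frac{\eta^n}{n!}=1$ (Gauduchon). The Gauduchon degree of $\{\omega\}$ is $\Gamma(\{\omega\})=\int_M S^{Ch}(\eta)\frac{\eta^n}{n!}$, where $\eta\in\{\omega\}$ is this Gauduchon metric. The hypothesis $S^{Ch}(\omega)=\Gamma(\{\omega\})$ means that $S^{Ch}(\omega)$ is constant, equal to $\Gamma(\{\omega\})$. The constant $c(\cdot)$: for $f\in C^\infty(M,\mathbb{R})$ with $\int_M f f_0\frac{\omega^n}{n!}<0$, $c(f)\in[-\infty,0)$ denotes a constant such that the equation $\Delta_\omega^{Ch}u+c-f\exp(2u/n)=0$ admits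 a solution $u\in C^\infty(M,\mathbb{R})$ for every $c\in(c(f),0)$; such a constant exists for every such $f$. *)

theory Defs
  imports "HOL-Analysis.Analysis" "HOL-Combinatorics.Permutations"
begin

section \<open>Calculus on open subsets of complex n-space\<close>

text \<open>The index type \<open>'n\<close> has the complex dimension \<open>n\<close> as its cardinality. Derivatives are real
  Frechet derivatives; all sets \<open>S\<close> below are meant to be open.\<close>

primrec Ck_on :: "nat \<Rightarrow> 'a::real_normed_vector set \<Rightarrow> ('a \<Rightarrow> 'b::real_normed_vector) \<Rightarrow> bool" where
  "Ck_on 0 S f \<longleftrightarrow> continuous_on S f"
| "Ck_on (Suc k) S f \<longleftrightarrow> (\<forall>x\<in>S. f differentiable (at x)) \<and>
     (\<forall>v. Ck_on k S (\<lambda>x. frechet_derivative f (at x) v))"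

definition smooth_on :: "'a::real_normed_vector set \<Rightarrow> ('a \<Rightarrow> 'b::real_normed_vector) \<Rightarrow> bool" where
  "smooth_on S f \<longleftrightarrow> (\<forall>k. Ck_on k S f)"

text \<open>The Wirtinger operators \<open>\<partial>/\<partial>z\<^sub>i\<close> and \<open>\<partial>/\<partial>\<close>(conjugate of \<open>z\<^sub>i\<close>).\<close>

definition dz :: "'n::finite \<Rightarrow> (complex^'n \<Rightarrow> complex) \<Rightarrow> complex^'n \<Rightarrow> complex" where
  "dz i f x = (frechet_derivative f (at x) (axis i 1) - \<i> * frechet_derivative f (at x) (axis i \<i>)) / 2"

definition dzbar :: "'n::finite \<Rightarrow> (complex^'n \<Rightarrow> complex) \<Rightarrow> complex^'n \<Rightarrow> complex" where
  "dzbar i f x = (frechet_derivative f (at x) (axis i 1) + \<i> * frechet_derivative f (at x) (axis i \<i>)) / 2"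

text \<open>Holomorphic maps in the convention of Griffiths and Harris: smooth maps whose components
  satisfy the Cauchy-Riemann equations in each variable.\<close>

definition holo_map_on :: "(complex^'n) set \<Rightarrow> (complex^'n \<Rightarrow> complex^'n) \<Rightarrow> bool" where
  "holo_map_on S F \<longleftrightarrow> smooth_on S F \<and> (\<forall>x\<in>S. \<forall>i k. dzbar i (\<lambda>y. F y $ k) x = 0)"

text \<open>Row \<open>k\<close>, column \<open>i\<close> of the holomorphic Jacobian is \<open>\<partial>F\<^sub>k/\<partial>z\<^sub>i\<close>.\<close>

definition jacobian :: "(complex^'n \<Rightarrow> complex^'n) \<Rightarrow> complex^'n \<Rightarrow> complex^'n^'n" where
  "jacobian F x = (\<chi> k i. dz i (\<lambda>y. F y $ k) x)"

section \<open>Differential forms in a chart\<close>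

text \<open>A complex-valued \<open>k\<close>-form at a point is an alternating real-multilinear function of \<open>k\<close> real
  tangent vectors in \<open>\<complex>\<^sup>n\<close>, given as a function on lists (of which only its values on lists of length \<open>k\<close>
  matter). The degrees enter the wedge product as parameters.\<close>

type_synonym 'n form = "(complex^'n) list \<Rightarrow> complex"

definition wedge :: "nat \<Rightarrow> nat \<Rightarrow> 'n::finite form \<Rightarrow> 'n form \<Rightarrow> 'n form" where
  "wedge k l \<alpha> \<beta> vs =
     (\<Sum>\<sigma> | \<sigma> permutes {..<k + l}. of_int (sign \<sigma>) *
        \<alpha> (map (\<lambda>i. vs ! \<sigma> i) [0..<k]) * \<beta> (map (\<lambda>i. vs ! \<sigma> i) [k..<k + l])) / (fact k * fact l)"

primrec form_power :: "'n::finite form \<Rightarrow> nat \<Rightarrow> 'n form" where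
  "form_power \<eta> 0 = (\<lambda>vs. 1)"
| "form_power \<eta> (Suc m) = wedge 2 (2 * m) \<eta> (form_power \<eta> m)"

text \<open>The operators \<open>\<partial>\<close> and its conjugate on forms: for \<open>\<alpha> = \<Sum> f\<^sub>I\<^sub>J dz\<^sub>I \<and> dzbar\<^sub>J\<close>, evaluating
  \<open>\<Sum> \<partial>f\<^sub>I\<^sub>J \<and> dz\<^sub>I \<and> dzbar\<^sub>J\<close> on constant vector fields gives the alternating sum below.\<close>

definition del :: "(complex^'n \<Rightarrow> 'n::finite form) \<Rightarrow> complex^'n \<Rightarrow> 'n form" where
  "del \<alpha> x vs = (\<Sum>m<length vs. (-1) ^ m *
     (\<Sum>j\<in>UNIV. dz j (\<lambda>y. \<alpha> y (take m vs @ drop (Suc m) vs)) x * (vs ! m $ j)))"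

definition delbar :: "(complex^'n \<Rightarrow> 'n::finite form) \<Rightarrow> complex^'n \<Rightarrow> 'n form" where
  "delbar \<alpha> x vs = (\<Sum>m<length vs. (-1) ^ m *
     (\<Sum>j\<in>UNIV. dzbar j (\<lambda>y. \<alpha> y (take m vs @ drop (Suc m) vs)) x * cnj (vs ! m $ j)))"

text \<open>The fundamental form \<open>\<i> \<Sum> H\<^sub>i\<^sub>j dz\<^sub>i \<and> dzbar\<^sub>j\<close> of a Hermitian matrix, as a 2-form.\<close>

definition fund_form :: "complex^'n^'n \<Rightarrow> 'n::finite form" where
  "fund_form H vs = \<i> * (\<Sum>i\<in>UNIV. \<Sum>j\<in>UNIV. H $ i $ j *
     (vs ! 0 $ i * cnj (vs ! 1 $ j) - vs ! 1 $ i * cnj (vs ! 0 $ j)))"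

text \<open>The Riemannian volume form \<open>\<omega>\<^sup>n / n!\<close>.\<close>

definition vol_form :: "complex^'n^'n \<Rightarrow> 'n::finite form" where
  "vol_form H vs = form_power (fund_form H) CARD('n) vs / fact CARD('n)"

text \<open>The standard positively oriented real frame \<open>\<partial>/\<partial>x\<^sub>1, \<partial>/\<partial>y\<^sub>1, \<dots>, \<partial>/\<partial>x\<^sub>n, \<partial>/\<partial>y\<^sub>n\<close>. The chosen
  enumeration of \<open>'n\<close> is immaterial: rearranging the pairs is an even permutation.\<close>

definition real_frame :: "(complex^'n::finite) list" where
  "real_frame = concat (map (\<lambda>i. [axis i 1, axis i \<i>]) (SOME is. distinct is \<and> set is = UNIV))"

section \<open>Chern curvature of a local metric\<close>

text \<open>\<open>\<omega>\<^sup>i\<^sup>j\<close> with \<open>\<Sum>\<^sub>j \<omega>\<^sup>i\<^sup>j \<omega>\<^sub>k\<^sub>j = \<delta>\<^sub>i\<^sub>k\<close> (second index conjugate): the transposed inverse.\<close>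

definition upper :: "complex^'n^'n \<Rightarrow> 'n::finite \<Rightarrow> 'n \<Rightarrow> complex" where
  "upper H i j = matrix_inv H $ j $ i"

text \<open>Christoffel symbols \<open>\<Gamma>\<^sup>p\<^sub>i\<^sub>k\<close> of the Chern connection. In a holomorphic frame its connection form
  is of type (1,0), and compatibility with the metric reads \<open>\<partial>\<^sub>i \<omega>\<^sub>k\<^sub>l = \<Sum>\<^sub>p \<Gamma>\<^sup>p\<^sub>i\<^sub>k \<omega>\<^sub>p\<^sub>l\<close>.\<close>

definition chern_christoffel ::
    "(complex^'n \<Rightarrow> complex^'n^'n) \<Rightarrow> complex^'n \<Rightarrow> 'n::finite \<Rightarrow> 'n \<Rightarrow> 'n \<Rightarrow> complex" where
  "chern_christoffel H x p i k = (\<Sum>l\<in>UNIV. upper (H x) p l * dz i (\<lambda>y. H y $ k $ l) x)"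

text \<open>\<open>R\<^sub>i\<^sub>j\<^sub>k\<^sub>l\<close> with \<open>j, l\<close> conjugate indices; the curvature of the connection form \<open>\<theta>\<close>
  is the (0,1)-derivative of \<open>\<theta>\<close>, whence the minus sign.\<close>

definition chern_curv ::
    "(complex^'n \<Rightarrow> complex^'n^'n) \<Rightarrow> complex^'n \<Rightarrow> 'n::finite \<Rightarrow> 'n \<Rightarrow> 'n \<Rightarrow> 'n \<Rightarrow> complex" where
  "chern_curv H x i j k l =
     (\<Sum>p\<in>UNIV. - dzbar j (\<lambda>y. chern_christoffel H y p i k) x * H x $ p $ l)"

definition chern_ricci ::
    "(complex^'n \<Rightarrow> complex^'n^'n) \<Rightarrow> complex^'n \<Rightarrow> 'n::finite \<Rightarrow> 'n \<Rightarrow> complex" where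
  "chern_ricci H x i j = (\<Sum>k\<in>UNIV. \<Sum>l\<in>UNIV. upper (H x) k l * chern_curv H x i j k l)"

definition chern_scalar_local ::
    "(complex^'n::finite \<Rightarrow> complex^'n^'n) \<Rightarrow> complex^'n \<Rightarrow> complex" where
  "chern_scalar_local H x = (\<Sum>i\<in>UNIV. \<Sum>j\<in>UNIV. upper (H x) i j * chern_ricci H x i j)"

section \<open>Complex manifolds\<close>

text \<open>The underlying space is the whole type \<open>'m\<close>. A chart is a domain together with a coordinate
  map, whose values outside the domain are irrelevant. (Compact spaces with such an atlas are
  automatically second countable.)\<close>

type_synonym ('m, 'n) chart = "'m set \<times> ('m \<Rightarrow> complex^'n)"

abbreviation cdom :: "('m, 'n::finite) chart \<Rightarrow> 'm set" where "cdom c \<equiv> fst c"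
abbreviation coord :: "('m, 'n::finite) chart \<Rightarrow> 'm \<Rightarrow> complex^'n" where "coord c \<equiv> snd c"

definition cimg :: "('m, 'n::finite) chart \<Rightarrow> (complex^'n) set" where
  "cimg c = coord c ` cdom c"

definition cinv :: "('m, 'n::finite) chart \<Rightarrow> complex^'n \<Rightarrow> 'm" where
  "cinv c = inv_into (cdom c) (coord c)"

definition complex_atlas :: "('m::t2_space, 'n::finite) chart set \<Rightarrow> bool" where
  "complex_atlas A \<longleftrightarrow>
     (\<Union>c\<in>A. cdom c) = UNIV \<and>
     (\<forall>c\<in>A. open (cdom c) \<and> open (cimg c) \<and> homeomorphism (cdom c) (cimg c) (coord c) (cinv c)) \<and>
     (\<forall>c\<in>A. \<forall>c'\<in>A. holo_map_on (coord c ` (cdom c \<inter> cdom c')) (coord c' \<circ> cinv c))"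

definition chart_at :: "('m, 'n::finite) chart set \<Rightarrow> 'm \<Rightarrow> ('m, 'n) chart" where
  "chart_at A p = (SOME c. c \<in> A \<and> p \<in> cdom c)"

definition smooth_fun :: "('m, 'n::finite) chart set \<Rightarrow> ('m \<Rightarrow> real) \<Rightarrow> bool" where
  "smooth_fun A u \<longleftrightarrow> (\<forall>c\<in>A. smooth_on (cimg c) (u \<circ> cinv c))"

definition holo_self_map :: "('m::t2_space, 'n::finite) chart set \<Rightarrow> ('m \<Rightarrow> 'm) \<Rightarrow> bool" where
  "holo_self_map A \<phi> \<longleftrightarrow> continuous_on UNIV \<phi> \<and>
     (\<forall>c\<in>A. \<forall>c'\<in>A. holo_map_on (coord c ` (cdom c \<inter> \<phi> -` cdom c')) (coord c' \<circ> \<phi> \<circ> cinv c))"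

definition Aut :: "('m::t2_space, 'n::finite) chart set \<Rightarrow> ('m \<Rightarrow> 'm) set" where
  "Aut A = {\<phi>. bij \<phi> \<and> holo_self_map A \<phi> \<and> holo_self_map A (inv \<phi>)}"

section \<open>Integration of top-degree forms\<close>

definition partition_of_unity ::
    "('m::t2_space, 'n::finite) chart set \<Rightarrow> (('m, 'n) chart \<times> ('m \<Rightarrow> real)) set \<Rightarrow> bool" where
  "partition_of_unity A P \<longleftrightarrow> finite P \<and>
     (\<forall>(c, \<rho>)\<in>P. c \<in> A \<and> smooth_fun A \<rho> \<and> (\<forall>p. 0 \<le> \<rho> p) \<and> closure {p. \<rho> p \<noteq> 0} \<subseteq> cdom c) \<and>
     (\<forall>p. (\<Sum>(c, \<rho>)\<in>P. \<rho> p) = 1)"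

text \<open>A form on the manifold is given by its expressions \<open>\<alpha> c\<close> in the charts \<open>c\<close>. For a compact
  manifold a finite partition of unity exists, and the integral does not depend on its choice.\<close>

definition form_integral ::
    "('m::t2_space, 'n::finite) chart set \<Rightarrow> (('m, 'n) chart \<Rightarrow> complex^'n \<Rightarrow> 'n form) \<Rightarrow> complex" where
  "form_integral A \<alpha> = (let P = (SOME P. partition_of_unity A P) in
     \<Sum>(c, \<rho>)\<in>P. LINT x:cimg c|lborel. of_real (\<rho> (cinv c x)) * \<alpha> c x real_frame)"

section \<open>Hermitian metrics\<close>

text \<open>A tensor of type (1,1) is given by its component functions \<open>\<omega>\<^sub>i\<^sub>j\<close> in each chart, on the
  image of the chart. Components are set to 0 elsewhere, so that equality of metrics is equality of
  tensors.\<close>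

type_synonym ('m, 'n) metric = "('m, 'n) chart \<Rightarrow> complex^'n \<Rightarrow> complex^'n^'n"

definition positive_hermitian :: "complex^'n^'n::finite \<Rightarrow> bool" where
  "positive_hermitian H \<longleftrightarrow> (\<forall>i j. H $ j $ i = cnj (H $ i $ j)) \<and>
     (\<forall>v. v \<noteq> 0 \<longrightarrow> 0 < Re (\<Sum>i\<in>UNIV. \<Sum>j\<in>UNIV. H $ i $ j * v $ i * cnj (v $ j)))"

text \<open>Components of the pull-back of a (1,1)-tensor along a holomorphic map with Jacobian \<open>J\<close>.\<close>

definition pull_matrix :: "complex^'n^'n \<Rightarrow> complex^'n^'n \<Rightarrow> complex^'n^'n::finite" where
  "pull_matrix J H = (\<chi> i j. \<Sum>k\<in>UNIV. \<Sum>l\<in>UNIV. J $ k $ i * cnj (J $ l $ j) * H $ k $ l)"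

definition hermitian_metric :: "('m::t2_space, 'n::finite) chart set \<Rightarrow> ('m, 'n) metric \<Rightarrow> bool" where
  "hermitian_metric A \<omega> \<longleftrightarrow>
     (\<forall>c\<in>A. smooth_on (cimg c) (\<omega> c) \<and> (\<forall>x\<in>cimg c. positive_hermitian (\<omega> c x))) \<and>
     (\<forall>c\<in>A. \<forall>c'\<in>A. \<forall>p\<in>cdom c \<inter> cdom c'.
        \<omega> c (coord c p) =
          pull_matrix (jacobian (coord c' \<circ> cinv c) (coord c p)) (\<omega> c' (coord c' p))) \<and>
     (\<forall>c x. c \<notin> A \<or> x \<notin> cimg c \<longrightarrow> \<omega> c x = 0)"

definition conformal_change ::
    "('m \<Rightarrow> real) \<Rightarrow> ('m, 'n::finite) metric \<Rightarrow> ('m, 'n) metric" where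
  "conformal_change u \<omega> = (\<lambda>c x. exp (2 * u (cinv c x) / CARD('n)) *\<^sub>R \<omega> c x)"

definition conformal_class ::
    "('m::t2_space, 'n::finite) chart set \<Rightarrow> ('m, 'n) metric \<Rightarrow> ('m, 'n) metric set" where
  "conformal_class A \<omega> = {conformal_change u \<omega> |u. smooth_fun A u}"

definition pullback ::
    "('m::t2_space, 'n::finite) chart set \<Rightarrow> ('m \<Rightarrow> 'm) \<Rightarrow> ('m, 'n) metric \<Rightarrow> ('m, 'n) metric" where
  "pullback A \<phi> \<omega> = (\<lambda>c x. if c \<in> A \<and> x \<in> cimg c
     then let c' = chart_at A (\<phi> (cinv c x)); F = coord c' \<circ> \<phi> \<circ> cinv c
          in pull_matrix (jacobian F x) (\<omega> c' (F x))
     else 0)"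

definition conformally_equivalent ::
    "('m::t2_space, 'n::finite) chart set \<Rightarrow> ('m, 'n) metric \<Rightarrow> ('m, 'n) metric \<Rightarrow> bool" where
  "conformally_equivalent A \<omega>\<^sub>1 \<omega> \<longleftrightarrow> (\<exists>\<phi>\<in>Aut A. pullback A \<phi> \<omega>\<^sub>1 \<in> conformal_class A \<omega>)"

definition integral_vol ::
    "('m::t2_space, 'n::finite) chart set \<Rightarrow> ('m, 'n) metric \<Rightarrow> ('m \<Rightarrow> real) \<Rightarrow> real" where
  "integral_vol A \<omega> f =
     Re (form_integral A (\<lambda>c x vs. of_real (f (cinv c x)) * vol_form (\<omega> c x) vs))"

definition volume :: "('m::t2_space, 'n::finite) chart set \<Rightarrow> ('m, 'n) metric \<Rightarrow> real" where
  "volume A \<omega> = integral_vol A \<omega> (\<lambda>p. 1)"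

text \<open>The local expressions of the Chern scalar curvature and of the Chern Laplacian are real and
  independent of the chart.\<close>

definition chern_scalar ::
    "('m::t2_space, 'n::finite) chart set \<Rightarrow> ('m, 'n) metric \<Rightarrow> 'm \<Rightarrow> real" where
  "chern_scalar A \<omega> p =
     (let c = chart_at A p in Re (chern_scalar_local (\<omega> c) (coord c p)))"

definition chern_laplacian ::
    "('m::t2_space, 'n::finite) chart set \<Rightarrow> ('m, 'n) metric \<Rightarrow> ('m \<Rightarrow> real) \<Rightarrow> 'm \<Rightarrow> real" where
  "chern_laplacian A \<omega> u p =
     (let c = chart_at A p; x = coord c p in
        Re (- 2 * (\<Sum>i\<in>UNIV. \<Sum>j\<in>UNIV. upper (\<omega> c x) i j *
          dz i (dzbar j (\<lambda>y. of_real (u (cinv c y)))) x)))"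

section \<open>Eccentricity function and Gauduchon degree\<close>

text \<open>The formal \<open>L\<^sup>2\<close>-adjoint is a function of smooth \<open>v\<close> only; for such \<open>v\<close> the
  function \<open>w\<close> exists and is unique.\<close>

definition chern_laplacian_adj ::
    "('m::t2_space, 'n::finite) chart set \<Rightarrow> ('m, 'n) metric \<Rightarrow> ('m \<Rightarrow> real) \<Rightarrow> 'm \<Rightarrow> real" where
  "chern_laplacian_adj A \<omega> v = (THE w. smooth_fun A w \<and>
     (\<forall>u. smooth_fun A u \<longrightarrow>
        integral_vol A \<omega> (\<lambda>p. chern_laplacian A \<omega> u p * v p) = integral_vol A \<omega> (\<lambda>p. u p * w p)))"

definition eccentricity ::
    "('m::t2_space, 'n::finite) chart set \<Rightarrow> ('m, 'n) metric \<Rightarrow> 'm \<Rightarrow> real" where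
  "eccentricity A \<omega> = (THE f. smooth_fun A f \<and> chern_laplacian_adj A \<omega> f = (\<lambda>p. 0) \<and>
     integral_vol A \<omega> f = volume A \<omega>)"

definition gauduchon ::
    "('m::t2_space, 'n::finite) chart set \<Rightarrow> ('m, 'n) metric \<Rightarrow> bool" where
  "gauduchon A \<eta> \<longleftrightarrow> (\<forall>c\<in>A. \<forall>x\<in>cimg c. \<forall>vs. length vs = 2 * CARD('n) \<longrightarrow>
     del (delbar (\<lambda>y. form_power (fund_form (\<eta> c y)) (CARD('n) - 1))) x vs = 0)"

definition gauduchon_metric ::
    "('m::t2_space, 'n::finite) chart set \<Rightarrow> ('m, 'n) metric \<Rightarrow> ('m, 'n) metric" where
  "gauduchon_metric A \<omega> = (THE \<eta>. \<eta> \<in> conformal_class A \<omega> \<and> gauduchon A \<eta> \<and> volume A \<eta> = 1)"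

definition gauduchon_degree ::
    "('m::t2_space, 'n::finite) chart set \<Rightarrow> ('m, 'n) metric \<Rightarrow> real" where
  "gauduchon_degree A \<omega> =
     (let \<eta> = gauduchon_metric A \<omega> in integral_vol A \<eta> (chern_scalar A \<eta>))"

section \<open>The constant c(f)\<close>

definition chern_equation_solvable ::
    "('m::t2_space, 'n::finite) chart set \<Rightarrow> ('m, 'n) metric \<Rightarrow> real \<Rightarrow> ('m \<Rightarrow> real) \<Rightarrow> bool" where
  "chern_equation_solvable A \<omega> k f \<longleftrightarrow> (\<exists>u. smooth_fun A u \<and>
     (\<forall>p. chern_laplacian A \<omega> u p + k - f p * exp (2 * u p / CARD('n)) = 0))"

text \<open>\<open>C\<close> is a possible choice of the constant \<open>c(f)\<close>, which may be \<open>-\<infinity>\<close>.\<close>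

definition threshold_constant ::
    "('m::t2_space, 'n::finite) chart set \<Rightarrow> ('m, 'n) metric \<Rightarrow> ('m \<Rightarrow> real) \<Rightarrow> ereal \<Rightarrow> bool" where
  "threshold_constant A \<omega> f C \<longleftrightarrow> C < 0 \<and>
     (\<forall>k::real. C < ereal k \<and> k < 0 \<longrightarrow> chern_equation_solvable A \<omega> k f)"

end

theory Submission
  imports Defs
begin

text \<open>Under a conformal change \<open>\<eta> = exp(2u/n) \<omega>\<close> the Chern scalar curvature becomes
  \<open>S(\<eta>) = exp(-2u/n) (S(\<omega>) + \<Delta>u)\<close>. Hence, as \<open>S(\<omega>) = \<Gamma>({\<omega>})\<close>, a solution \<open>u\<close> of the equation
  defining \<open>c(g \<circ> \<phi>)\<close> with constant \<open>\<Gamma>({\<omega>}) > c(g \<circ> \<phi>)\<close> gives a metric \<open>\<eta>\<close> in the conformal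
  class of \<open>\<omega>\<close> with \<open>S(\<eta>) = g \<circ> \<phi>\<close>, and by the invariance of \<open>S\<close> under biholomorphisms the pull-back
  of \<open>\<eta>\<close> along \<open>\<phi>\<^sup>-\<^sup>1\<close> has curvature \<open>g\<close>.

  Both the conformal formula and the invariance are read off the trace of the connection form
  \<open>tr (H\<^sup>-\<^sup>1 \<partial>\<^sub>i H)\<close>, whose derivative with respect to the conjugate of \<open>z\<^sub>j\<close> is minus the Chern-Ricci
  tensor: a conformal factor \<open>exp f\<close> adds \<open>n \<partial>\<^sub>i f\<close> to it, and a holomorphic change of coordinates adds a
  holomorphic function.\<close>

section \<open>Smooth functions\<close>

lemma frechet_derivative_eq:
  "(f has_derivative f') (at x) \<Longrightarrow> frechet_derivative f (at x) = f'"
  by (metis frechet_derivative_at)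

lemma differentiable_cong_open:
  assumes "open S" "x \<in> S" "\<And>y. y \<in> S \<Longrightarrow> f y = g y"
  shows "f differentiable (at x) \<longleftrightarrow> g differentiable (at x)"
  unfolding differentiable_def
  by (metis (no_types, lifting) assms has_derivative_transform_within_open)

lemma frechet_derivative_cong_open:
  assumes "open S" "x \<in> S" "\<And>y. y \<in> S \<Longrightarrow> f y = g y"
  shows "frechet_derivative f (at x) = frechet_derivative g (at x)"
proof -
  have "(f has_derivative D) (at x) \<longleftrightarrow> (g has_derivative D) (at x)" for D
    by (metis (no_types, lifting) assms has_derivative_transform_within_open)
  then show ?thesis
    by (simp add: frechet_derivative_def)
qed

section \<open>Functions of finite differentiability class\<close>

lemma Ck_on_cong:
  assumes "open S" "\<And>x. x \<in> S \<Longrightarrow> f x = g x"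
  shows "Ck_on k S f \<longleftrightarrow> Ck_on k S g"
  using assms(2)
proof (induction k arbitrary: f g)
  case 0
  then show ?case by (simp cong: continuous_on_cong)
next
  case (Suc k)
  have "Ck_on k S (\<lambda>x. frechet_derivative f (at x) v) = Ck_on k S (\<lambda>x. frechet_derivative g (at x) v)" for v
    by (rule Suc.IH) (metis Suc.prems assms(1) frechet_derivative_cong_open)
  moreover have "f differentiable at x \<longleftrightarrow> g differentiable at x" if "x \<in> S" for x
    using Suc.prems assms(1) differentiable_cong_open that by blast
  ultimately show ?case by simp
qed

lemma Ck_on_imp_differentiable: "Ck_on (Suc k) S f \<Longrightarrow> x \<in> S \<Longrightarrow> f differentiable at x"
  by simp

text \<open>The recursion passes from \<open>f\<close> to its directional derivatives, so only the
  bottom level carries content: differentiability at every point gives continuity.\<close>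

lemma Ck_on_Suc_imp: "Ck_on (Suc k) S f \<Longrightarrow> Ck_on k S f"
proof (induction k arbitrary: f)
  case 0
  then show ?case
    by (auto intro: continuous_at_imp_continuous_on differentiable_imp_continuous_within)
next
  case (Suc k)
  then show ?case
    by (metis Ck_on.simps(2))
qed

text \<open>Derivatives are taken in full neighbourhoods (\<open>at x\<close>) and never refer to
  \<open>S\<close>, and continuity at a point is seen on any open neighbourhood of it. This allows a
  different chart to be used around each point.\<close>

lemma Ck_on_locally:
  assumes "\<And>x. x \<in> S \<Longrightarrow> \<exists>U. open U \<and> x \<in> U \<and> Ck_on k U f"
  shows "Ck_on k S f"
  using assms
proof (induction k arbitrary: f)
  case 0
  have "continuous (at x) f" if "x \<in> S" for x
    using 0[OF that] continuous_on_eq_continuous_at by auto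
  then show ?case
    by (simp add: continuous_at_imp_continuous_on)
next
  case (Suc k)
  show ?case
    unfolding Ck_on.simps
  proof (intro conjI allI ballI)
    show "f differentiable at x" if "x \<in> S" for x
      using Suc.prems[OF that] by auto
    show "Ck_on k S (\<lambda>x. frechet_derivative f (at x) v)" for v
    proof (rule Suc.IH)
      show "\<exists>U. open U \<and> x \<in> U \<and> Ck_on k U (\<lambda>x. frechet_derivative f (at x) v)" if "x \<in> S" for x
        using Suc.prems[OF that] by auto
    qed
  qed
qed

lemma Ck_on_const: "Ck_on k S (\<lambda>x. c)"
  by (induction k arbitrary: c) simp_all

lemma Ck_on_bounded_linear:
  assumes "bounded_linear h"
  shows "open S \<Longrightarrow> Ck_on k S f \<Longrightarrow> Ck_on k S (\<lambda>x. h (f x))"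
proof (induction k arbitrary: f)
  case 0
  then show ?case
    by (simp add: assms bounded_linear.continuous_on)
next
  case (Suc k)
  have d: "((\<lambda>y. h (f y)) has_derivative (\<lambda>v. h (frechet_derivative f (at x) v))) (at x)" if "x \<in> S" for x
    by (rule bounded_linear.has_derivative[OF assms])
      (use Suc.prems that in \<open>simp add: frechet_derivative_works\<close>)
  have "Ck_on k S (\<lambda>x. frechet_derivative (\<lambda>y. h (f y)) (at x) v)" for v
  proof -
    have "Ck_on k S (\<lambda>x. h (frechet_derivative f (at x) v))"
      using Suc by simp
    then show ?thesis
      by (subst Ck_on_cong[OF \<open>open S\<close>, where g="\<lambda>x. h (frechet_derivative f (at x) v)"])
        (simp_all add: frechet_derivative_eq[OF d])
  qed
  then show ?case
    using d by (auto simp: differentiable_def)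
qed

lemma Ck_on_add:
  "open S \<Longrightarrow> Ck_on k S f \<Longrightarrow> Ck_on k S g \<Longrightarrow> Ck_on k S (\<lambda>x. f x + g x)"
proof (induction k arbitrary: f g)
  case 0
  then show ?case by (simp add: continuous_on_add)
next
  case (Suc k)
  have d: "((\<lambda>y. f y + g y) has_derivative
      (\<lambda>v. frechet_derivative f (at x) v + frechet_derivative g (at x) v)) (at x)" if "x \<in> S" for x
    by (rule has_derivative_add) (use Suc.prems that in \<open>simp_all add: frechet_derivative_works\<close>)
  have "Ck_on k S (\<lambda>x. frechet_derivative (\<lambda>y. f y + g y) (at x) v)" for v
  proof -
    have "Ck_on k S (\<lambda>x. frechet_derivative f (at x) v + frechet_derivative g (at x) v)"
      using Suc by simp
    then show ?thesis
      by (subst Ck_on_cong[OF \<open>open S\<close>, where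
            g="\<lambda>x. frechet_derivative f (at x) v + frechet_derivative g (at x) v"])
        (simp_all add: frechet_derivative_eq[OF d])
  qed
  then show ?case
    using d by (auto simp: differentiable_def)
qed

text \<open>The product rule yields two terms of the same bilinear shape, each with one factor
  differentiated and the other merely lowered by \<open>Ck_on_Suc_imp\<close>, so the induction
  closes.\<close>

lemma Ck_on_bilinear:
  assumes "bounded_bilinear h"
  shows "open S \<Longrightarrow> Ck_on k S f \<Longrightarrow> Ck_on k S g \<Longrightarrow> Ck_on k S (\<lambda>x. h (f x) (g x))"
proof (induction k arbitrary: f g)
  case 0
  then show ?case by (simp add: bounded_bilinear.continuous_on[OF assms])
next
  case (Suc k)
  have d: "((\<lambda>y. h (f y) (g y)) has_derivative
      (\<lambda>v. h (f x) (frechet_derivative g (at x) v) + h (frechet_derivative f (at x) v) (g x))) (at x)"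
    if "x \<in> S" for x
    by (rule bounded_bilinear.FDERIV[OF assms])
      (use Suc.prems that in \<open>simp_all add: frechet_derivative_works\<close>)
  have "Ck_on k S (\<lambda>x. frechet_derivative (\<lambda>y. h (f y) (g y)) (at x) v)" for v
  proof -
    have "Ck_on k S (\<lambda>x. h (f x) (frechet_derivative g (at x) v) + h (frechet_derivative f (at x) v) (g x))"
      using Suc.prems Ck_on_Suc_imp[OF Suc.prems(2)] Ck_on_Suc_imp[OF Suc.prems(3)]
      by (intro Ck_on_add Suc.IH) simp_all
    then show ?thesis
      by (subst Ck_on_cong[OF \<open>open S\<close>, where
            g="\<lambda>x. h (f x) (frechet_derivative g (at x) v) + h (frechet_derivative f (at x) v) (g x)"])
        (simp_all add: frechet_derivative_eq[OF d])
  qed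
  then show ?case
    using d by (auto simp: differentiable_def)
qed

lemma Ck_on_sum:
  assumes "open S" "\<And>i. i \<in> I \<Longrightarrow> Ck_on k S (f i)"
  shows "Ck_on k S (\<lambda>x. \<Sum>i\<in>I. f i x)"
  using assms(2)
  by (induction I rule: infinite_finite_induct) (auto intro: Ck_on_const Ck_on_add assms)

text \<open>\<open>Ck_on\<close> controls derivatives only along fixed directions, whereas the chain
  rule differentiates the outer map along a varying one. Expanding in a basis makes the directions
  constant.\<close>

lemma frechet_derivative_euclidean:
  fixes f :: "'a::euclidean_space \<Rightarrow> 'b::real_normed_vector"
  assumes "f differentiable (at x)"
  shows "frechet_derivative f (at x) v = (\<Sum>b\<in>Basis. (v \<bullet> b) *\<^sub>R frechet_derivative f (at x) b)"
proof -
  have "linear (frechet_derivative f (at x))"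
    using assms by (rule linear_frechet_derivative)
  then have "frechet_derivative f (at x) (\<Sum>b\<in>Basis. (v \<bullet> b) *\<^sub>R b)
      = (\<Sum>b\<in>Basis. (v \<bullet> b) *\<^sub>R frechet_derivative f (at x) b)"
    by (simp add: linear_sum linear_cmul)
  then show ?thesis
    by (simp add: euclidean_representation)
qed

text \<open>Induction with \<open>f\<close> fixed and \<open>g\<close> arbitrary: the chain rule
  turns a derivative of the composite into a finite sum of derivatives of \<open>f\<close> times
  derivatives of \<open>g\<close> along basis vectors, evaluated after \<open>f\<close>, and the
  induction hypothesis covers the latter.\<close>

lemma Ck_on_compose:
  fixes f :: "'a::real_normed_vector \<Rightarrow> 'b::euclidean_space" and g :: "'b \<Rightarrow> 'c::real_normed_vector"
  assumes "open S" "\<And>x. x \<in> S \<Longrightarrow> f x \<in> T"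
  shows "Ck_on k S f \<Longrightarrow> Ck_on k T g \<Longrightarrow> Ck_on k S (\<lambda>x. g (f x))"
proof (induction k arbitrary: g)
  case 0
  then show ?case
    using assms(2) by (auto intro: continuous_on_compose2)
next
  case (Suc k)
  let ?D = "\<lambda>x v. \<Sum>b\<in>Basis. (frechet_derivative f (at x) v \<bullet> b) *\<^sub>R frechet_derivative g (at (f x)) b"
  have d: "((\<lambda>y. g (f y)) has_derivative ?D x) (at x)" if "x \<in> S" for x
  proof -
    have f: "(f has_derivative frechet_derivative f (at x)) (at x)"
      using Suc.prems that by (simp add: frechet_derivative_works)
    have g': "g differentiable (at (f x))"
      using Suc.prems that assms(2) by simp
    then have "(g has_derivative frechet_derivative g (at (f x))) (at (f x))"
      by (simp add: frechet_derivative_works)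
    from has_derivative_compose[OF f this] show ?thesis
      by (subst (asm) frechet_derivative_euclidean[OF g'])
  qed
  have "Ck_on k S (\<lambda>x. frechet_derivative (\<lambda>y. g (f y)) (at x) v)" for v
  proof -
    have "Ck_on k S (\<lambda>x. ?D x v)"
    proof (intro Ck_on_sum Ck_on_bilinear[OF bounded_bilinear_scaleR]
        Ck_on_bounded_linear[OF bounded_linear_inner_left] assms(1))
      show "Ck_on k S (\<lambda>x. frechet_derivative f (at x) v)"
        using Suc.prems by simp
      show "Ck_on k S (\<lambda>x. frechet_derivative g (at (f x)) b)" for b
        by (rule Suc.IH) (use Suc.prems Ck_on_Suc_imp[OF Suc.prems(1)] in simp_all)
    qed
    then show ?thesis
      by (subst Ck_on_cong[OF \<open>open S\<close>, where g="\<lambda>x. ?D x v"])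
        (simp_all add: frechet_derivative_eq[OF d])
  qed
  then show ?case
    using d by (auto simp: differentiable_def)
qed

text \<open>Each directional derivative is a constant multiple of \<open>exp\<close> itself, so
  every class follows from the previous one.\<close>

lemma Ck_on_exp: "Ck_on k UNIV (exp :: real \<Rightarrow> real)"
proof (induction k)
  case 0
  then show ?case by (simp add: continuous_on_exp)
next
  case (Suc k)
  have d: "(exp has_derivative (\<lambda>v. v * exp x)) (at x)" for x :: real
    by (auto intro!: derivative_eq_intros)
  have "Ck_on k UNIV (\<lambda>x. v * exp x)" for v :: real
    by (rule Ck_on_bounded_linear[OF bounded_linear_mult_right _ Suc]) simp
  then show ?case
    using d by (auto simp: frechet_derivative_eq[OF d] differentiable_def)
qed

section \<open>Closure properties of smooth functions\<close>

lemma smooth_on_imp_differentiable: "smooth_on S f \<Longrightarrow> x \<in> S \<Longrightarrow> f differentiable (at x)"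
  using Ck_on_imp_differentiable unfolding smooth_on_def by blast

lemma smooth_on_imp_Ck_on: "smooth_on S f \<Longrightarrow> Ck_on k S f"
  by (simp add: smooth_on_def)

lemma smooth_on_frechet_derivative:
  "smooth_on S f \<Longrightarrow> smooth_on S (\<lambda>x. frechet_derivative f (at x) v)"
  unfolding smooth_on_def using Ck_on.simps(2) by blast

lemma smooth_on_cong:
  "open S \<Longrightarrow> (\<And>x. x \<in> S \<Longrightarrow> f x = g x) \<Longrightarrow> smooth_on S f \<longleftrightarrow> smooth_on S g"
  unfolding smooth_on_def using Ck_on_cong by blast

lemma smooth_on_locally:
  "(\<And>x. x \<in> S \<Longrightarrow> \<exists>U. open U \<and> x \<in> U \<and> smooth_on U f) \<Longrightarrow> smooth_on S f"
  unfolding smooth_on_def by (intro allI Ck_on_locally) blast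

lemma smooth_on_const: "smooth_on S (\<lambda>x. c)"
  by (simp add: smooth_on_def Ck_on_const)

lemma smooth_on_bounded_linear:
  "bounded_linear h \<Longrightarrow> open S \<Longrightarrow> smooth_on S f \<Longrightarrow> smooth_on S (\<lambda>x. h (f x))"
  using Ck_on_bounded_linear[of h S _ f] by (simp add: smooth_on_def)

lemma smooth_on_add:
  "open S \<Longrightarrow> smooth_on S f \<Longrightarrow> smooth_on S g \<Longrightarrow> smooth_on S (\<lambda>x. f x + g x)"
  using Ck_on_add[of S _ f g] by (simp add: smooth_on_def)

lemma smooth_on_bilinear:
  "bounded_bilinear h \<Longrightarrow> open S \<Longrightarrow> smooth_on S f \<Longrightarrow> smooth_on S g
    \<Longrightarrow> smooth_on S (\<lambda>x. h (f x) (g x))"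
  using Ck_on_bilinear[of h S _ f g] by (simp add: smooth_on_def)

lemmas smooth_on_mult = smooth_on_bilinear[OF bounded_bilinear_mult]
lemmas smooth_on_scaleR = smooth_on_bilinear[OF bounded_bilinear_scaleR]

lemma smooth_on_sum:
  "open S \<Longrightarrow> (\<And>i. i \<in> I \<Longrightarrow> smooth_on S (f i)) \<Longrightarrow> smooth_on S (\<lambda>x. \<Sum>i\<in>I. f i x)"
  by (simp add: smooth_on_def Ck_on_sum)

lemma smooth_on_compose:
  fixes f :: "'a::real_normed_vector \<Rightarrow> 'b::euclidean_space"
  shows "open S \<Longrightarrow> (\<And>x. x \<in> S \<Longrightarrow> f x \<in> T) \<Longrightarrow> smooth_on S f \<Longrightarrow> smooth_on T g
    \<Longrightarrow> smooth_on S (\<lambda>x. g (f x))"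
  unfolding smooth_on_def by (blast intro: Ck_on_compose)

lemma smooth_on_exp:
  "open S \<Longrightarrow> smooth_on S f \<Longrightarrow> smooth_on S (\<lambda>x. exp (f x :: real))"
  using smooth_on_compose[of S f UNIV exp] by (simp add: smooth_on_def Ck_on_exp)

lemma smooth_on_componentwise:
  fixes f :: "'a::real_normed_vector \<Rightarrow> 'b::euclidean_space"
  assumes "open S" "\<And>b. b \<in> Basis \<Longrightarrow> smooth_on S (\<lambda>x. f x \<bullet> b)"
  shows "smooth_on S f"
proof -
  have "smooth_on S (\<lambda>x. \<Sum>b\<in>Basis. (f x \<bullet> b) *\<^sub>R b)"
    by (intro smooth_on_sum smooth_on_scaleR smooth_on_const assms)
  then show ?thesis
    by (simp add: euclidean_representation)
qed

text \<open>Every basis vector is some \<open>axis i e\<close>, so pairing with it gives a linear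
  function of the \<open>i\<close>-th entry. Applied twice, this reduces smoothness of a
  matrix-valued map to its entries.\<close>

lemma smooth_on_vec:
  fixes f :: "'a::real_normed_vector \<Rightarrow> 'b::euclidean_space^'n"
  assumes "open S" "\<And>i. smooth_on S (\<lambda>x. f x $ i)"
  shows "smooth_on S f"
proof (rule smooth_on_componentwise[OF assms(1)])
  fix b :: "'b^'n" assume "b \<in> Basis"
  then obtain i e where "b = axis i e"
    by (auto simp: Basis_vec_def)
  then show "smooth_on S (\<lambda>x. f x \<bullet> b)"
    by (simp add: inner_axis)
      (intro smooth_on_bounded_linear[OF bounded_linear_inner_left] assms)
qed

lemma smooth_on_nth:
  "open S \<Longrightarrow> smooth_on S f \<Longrightarrow> smooth_on S (\<lambda>x. f x $ i)"
  by (rule smooth_on_bounded_linear[OF bounded_linear_vec_nth])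

section \<open>Symmetry of second derivatives\<close>

text \<open>Two applications of the mean value theorem to the second difference of \<open>f\<close> along \<open>v\<close> and \<open>w\<close>.\<close>

lemma second_difference_mvt:
  fixes f :: "'a::real_normed_vector \<Rightarrow> real"
  assumes ball: "\<And>s t. 0 \<le> s \<Longrightarrow> s \<le> h \<Longrightarrow> 0 \<le> t \<Longrightarrow> t \<le> h \<Longrightarrow> x + s *\<^sub>R v + t *\<^sub>R w \<in> S"
    and f: "Ck_on 2 S f" and h: "h > 0"
  obtains s t where "0 \<le> s" "s \<le> h" "0 \<le> t" "t \<le> h"
    "f (x + h *\<^sub>R v + h *\<^sub>R w) - f (x + h *\<^sub>R v) - f (x + h *\<^sub>R w) + f x =
      h * h * frechet_derivative (\<lambda>y. frechet_derivative f (at y) v) (at (x + s *\<^sub>R v + t *\<^sub>R w)) w"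
proof -
  let ?f' = "\<lambda>y. frechet_derivative f (at y)"
  let ?g = "\<lambda>y. ?f' y v"
  have f1: "(f has_derivative ?f' y) (at y)" if "y \<in> S" for y
    using f that by (simp add: numeral_2_eq_2 frechet_derivative_works)
  have g1: "(?g has_derivative frechet_derivative ?g (at y)) (at y)" if "y \<in> S" for y
    using f that by (simp add: numeral_2_eq_2 frechet_derivative_works[symmetric])
  have lin: "?f' y (r *\<^sub>R z) = r * ?f' y z" if "y \<in> S" for y r z
    using has_derivative_linear[OF f1[OF that]] by (simp add: linear_cmul)
  have lin2: "frechet_derivative ?g (at y) (r *\<^sub>R z) = r * frechet_derivative ?g (at y) z" if "y \<in> S" for y r z
    using has_derivative_linear[OF g1[OF that]] by (simp add: linear_cmul)
  \<comment> \<open>First mean value: the increment along \<open>w\<close>, as a function of the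
    step along \<open>v\<close>.\<close>
  let ?a = "\<lambda>s. f (x + s *\<^sub>R v + h *\<^sub>R w) - f (x + s *\<^sub>R v)"
  have ad: "(?a has_derivative (\<lambda>r. r * (?g (x + s *\<^sub>R v + h *\<^sub>R w) - ?g (x + s *\<^sub>R v)))) (at s within {0..h})"
    if "0 \<le> s" "s \<le> h" for s
  proof -
    have S: "x + s *\<^sub>R v + h *\<^sub>R w \<in> S" "x + s *\<^sub>R v \<in> S"
      using ball[of s h] ball[of s 0] that h by auto
    have "((\<lambda>s. f (x + s *\<^sub>R v + h *\<^sub>R w)) has_derivative (\<lambda>r. ?f' (x + s *\<^sub>R v + h *\<^sub>R w) (r *\<^sub>R v))) (at s within {0..h})"
      by (rule has_derivative_compose[of "\<lambda>s. x + s *\<^sub>R v + h *\<^sub>R w", OF _ f1[OF S(1)]])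
        (auto intro!: derivative_eq_intros)
    moreover have "((\<lambda>s. f (x + s *\<^sub>R v)) has_derivative (\<lambda>r. ?f' (x + s *\<^sub>R v) (r *\<^sub>R v))) (at s within {0..h})"
      by (rule has_derivative_compose[of "\<lambda>s. x + s *\<^sub>R v", OF _ f1[OF S(2)]])
        (auto intro!: derivative_eq_intros)
    ultimately show ?thesis
      unfolding lin[OF S(1)] lin[OF S(2)] right_diff_distrib by (rule has_derivative_diff)
  qed
  obtain s where s: "0 < s" "s < h"
      "?a h - ?a 0 = (h - 0) * (?g (x + s *\<^sub>R v + h *\<^sub>R w) - ?g (x + s *\<^sub>R v))"
    using mvt_simple[OF h, of ?a "\<lambda>s r. r * (?g (x + s *\<^sub>R v + h *\<^sub>R w) - ?g (x + s *\<^sub>R v))"] ad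
    by auto
  \<comment> \<open>Second mean value: along \<open>w\<close>, with the intermediate
    \<open>s\<close> kept fixed.\<close>
  let ?b = "\<lambda>t. ?g (x + s *\<^sub>R v + t *\<^sub>R w)"
  have bd: "(?b has_derivative (\<lambda>r. r * frechet_derivative ?g (at (x + s *\<^sub>R v + t *\<^sub>R w)) w)) (at t within {0..h})"
    if "0 \<le> t" "t \<le> h" for t
  proof -
    have S: "x + s *\<^sub>R v + t *\<^sub>R w \<in> S"
      using ball[of s t] that s by auto
    have "(?b has_derivative (\<lambda>r. frechet_derivative ?g (at (x + s *\<^sub>R v + t *\<^sub>R w)) (r *\<^sub>R w))) (at t within {0..h})"
      by (rule has_derivative_compose[of "\<lambda>t. x + s *\<^sub>R v + t *\<^sub>R w", OF _ g1[OF S]])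
        (auto intro!: derivative_eq_intros)
    then show ?thesis
      by (simp add: lin2 S)
  qed
  obtain t where t: "0 < t" "t < h"
      "?b h - ?b 0 = (h - 0) * frechet_derivative ?g (at (x + s *\<^sub>R v + t *\<^sub>R w)) w"
    using mvt_simple[OF h, of ?b "\<lambda>t r. r * frechet_derivative ?g (at (x + s *\<^sub>R v + t *\<^sub>R w)) w"] bd
    by auto
  show ?thesis
    by (rule that[of s t]) (use s t in auto)
qed

text \<open>Both mixed derivatives, at points close to \<open>x\<close>, represent the same second
  difference divided by \<open>h * h\<close>; their continuity at \<open>x\<close> then identifies
  the values there.\<close>

lemma second_derivative_symmetric_real:
  fixes f :: "'a::real_normed_vector \<Rightarrow> real"
  assumes "open S" "x \<in> S" and f: "Ck_on 2 S f"
  shows "frechet_derivative (\<lambda>y. frechet_derivative f (at y) v) (at x) w =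
    frechet_derivative (\<lambda>y. frechet_derivative f (at y) w) (at x) v"
proof -
  let ?A = "\<lambda>y. frechet_derivative (\<lambda>y. frechet_derivative f (at y) v) (at y) w"
  let ?B = "\<lambda>y. frechet_derivative (\<lambda>y. frechet_derivative f (at y) w) (at y) v"
  have cont: "isCont ?A x" "isCont ?B x"
    using f assms by (simp_all add: numeral_2_eq_2 continuous_on_eq_continuous_at)
  have "\<bar>?A x - ?B x\<bar> \<le> e" if e: "e > 0" for e
  proof -
    obtain d1 where d1: "d1 > 0" "\<And>y. dist y x < d1 \<Longrightarrow> \<bar>?A y - ?A x\<bar> < e/2"
      using cont(1) e unfolding continuous_at_eps_delta dist_real_def by (meson half_gt_zero)
    obtain d2 where d2: "d2 > 0" "\<And>y. dist y x < d2 \<Longrightarrow> \<bar>?B y - ?B x\<bar> < e/2"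
      using cont(2) e unfolding continuous_at_eps_delta dist_real_def by (meson half_gt_zero)
    obtain d3 where d3: "d3 > 0" "\<And>y. dist y x < d3 \<Longrightarrow> y \<in> S"
      using assms open_dist by blast
    define d where "d = min d1 (min d2 d3)"
    have d: "d > 0" "d \<le> d1" "d \<le> d2" "d \<le> d3"
      using d1 d2 d3 by (auto simp: d_def)
    \<comment> \<open>With this step the whole parallelogram spanned at \<open>x\<close> by
      \<open>h *\<^sub>R v\<close> and \<open>h *\<^sub>R w\<close> stays within distance
      \<open>d\<close> of \<open>x\<close>; the summand 1 keeps the denominator positive even for
      \<open>v = w = 0\<close>.\<close>
    define h where "h = d / (norm v + norm w + 1)"
    have N: "norm v + norm w + 1 > 0"
      by (meson add_nonneg_pos add_nonneg_nonneg norm_ge_zero zero_less_one)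
    have h: "h > 0"
      using d N by (simp add: h_def)
    have near: "dist (x + s *\<^sub>R v + t *\<^sub>R w) x < d" if "0 \<le> s" "s \<le> h" "0 \<le> t" "t \<le> h" for s t
    proof -
      have "dist (x + s *\<^sub>R v + t *\<^sub>R w) x = norm (s *\<^sub>R v + t *\<^sub>R w)"
        by (simp add: dist_norm)
      also have "\<dots> \<le> s * norm v + t * norm w"
        using norm_triangle_ineq[of "s *\<^sub>R v" "t *\<^sub>R w"] that by simp
      also have "\<dots> \<le> h * norm v + h * norm w"
        using that by (intro add_mono mult_right_mono) auto
      also have "\<dots> < h * (norm v + norm w + 1)"
        using h by (simp add: algebra_simps)
      also have "\<dots> = d"
        using N by (simp add: h_def)
      finally show ?thesis .
    qed
    have in_S: "x + s *\<^sub>R v + t *\<^sub>R w \<in> S" if "0 \<le> s" "s \<le> h" "0 \<le> t" "t \<le> h" for s t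
      by (intro d3(2) less_le_trans[OF near d(4)] that)
    obtain s t where st: "0 \<le> s" "s \<le> h" "0 \<le> t" "t \<le> h"
      and eq1: "f (x + h *\<^sub>R v + h *\<^sub>R w) - f (x + h *\<^sub>R v) - f (x + h *\<^sub>R w) + f x =
          h * h * ?A (x + s *\<^sub>R v + t *\<^sub>R w)"
      by (rule second_difference_mvt[OF in_S f h])
    have near': "dist (x + s *\<^sub>R w + t *\<^sub>R v) x < d" if "0 \<le> s" "s \<le> h" "0 \<le> t" "t \<le> h" for s t
      using near[of t s] that by (simp add: algebra_simps)
    have in_S': "x + s *\<^sub>R w + t *\<^sub>R v \<in> S" if "0 \<le> s" "s \<le> h" "0 \<le> t" "t \<le> h" for s t
      by (intro d3(2) less_le_trans[OF near' d(4)] that)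
    obtain s' t' where st': "0 \<le> s'" "s' \<le> h" "0 \<le> t'" "t' \<le> h"
      and eq2: "f (x + h *\<^sub>R w + h *\<^sub>R v) - f (x + h *\<^sub>R w) - f (x + h *\<^sub>R v) + f x =
          h * h * ?B (x + s' *\<^sub>R w + t' *\<^sub>R v)"
      by (rule second_difference_mvt[OF in_S' f h])
    \<comment> \<open>The second difference is symmetric in \<open>v\<close> and \<open>w\<close>,
      so both mean value representations have the same left-hand side.\<close>
    have "h * h * ?A (x + s *\<^sub>R v + t *\<^sub>R w) = h * h * ?B (x + s' *\<^sub>R w + t' *\<^sub>R v)"
      unfolding eq1[symmetric] eq2[symmetric] by (simp add: algebra_simps)
    then have "?A (x + s *\<^sub>R v + t *\<^sub>R w) = ?B (x + s' *\<^sub>R w + t' *\<^sub>R v)"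
      using h by simp
    moreover have "\<bar>?A (x + s *\<^sub>R v + t *\<^sub>R w) - ?A x\<bar> < e/2"
      using near[OF st] d by (intro d1) auto
    moreover have "\<bar>?B (x + s' *\<^sub>R w + t' *\<^sub>R v) - ?B x\<bar> < e/2"
      using near'[OF st'] d by (intro d2) auto
    ultimately show ?thesis
      by linarith
  qed
  \<comment> \<open>Taking \<open>e\<close> to be half the distance of the two values forces that
    distance to vanish.\<close>
  from this[of "\<bar>?A x - ?B x\<bar> / 2"] show ?thesis
    by (cases "?A x = ?B x") auto
qed

lemma frechet_derivative_bounded_linear:
  assumes "bounded_linear h" "f differentiable (at x)"
  shows "frechet_derivative (\<lambda>y. h (f y)) (at x) v = h (frechet_derivative f (at x) v)"
proof -
  have "((\<lambda>y. h (f y)) has_derivative (\<lambda>v. h (frechet_derivative f (at x) v))) (at x)"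
    by (rule bounded_linear.has_derivative[OF assms(1)])
      (use assms(2) in \<open>simp add: frechet_derivative_works\<close>)
  then show ?thesis
    by (simp add: frechet_derivative_eq)
qed

text \<open>Pairing with a basis vector is bounded linear and commutes with both differentiations,
  which reduces the claim to real-valued functions.\<close>

lemma second_derivative_symmetric:
  fixes f :: "'a::real_normed_vector \<Rightarrow> 'b::euclidean_space"
  assumes "open S" "x \<in> S" and f: "Ck_on 2 S f"
  shows "frechet_derivative (\<lambda>y. frechet_derivative f (at y) v) (at x) w =
    frechet_derivative (\<lambda>y. frechet_derivative f (at y) w) (at x) v"
proof (rule euclidean_eqI)
  fix b :: 'b
  let ?h = "\<lambda>z. z \<bullet> b"
  have bl: "bounded_linear ?h"
    by (rule bounded_linear_inner_left)
  have d: "f differentiable (at y)" if "y \<in> S" for y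
    using f that by (simp add: numeral_2_eq_2)
  have "?h (frechet_derivative (\<lambda>y. frechet_derivative f (at y) v) (at x) w) =
      frechet_derivative (\<lambda>y. frechet_derivative (\<lambda>z. ?h (f z)) (at y) v) (at x) w" for v w
  proof -
    have "?h (frechet_derivative (\<lambda>y. frechet_derivative f (at y) v) (at x) w) =
      frechet_derivative (\<lambda>y. ?h (frechet_derivative f (at y) v)) (at x) w"
      by (rule frechet_derivative_bounded_linear[OF bl, symmetric])
        (use f assms(2) in \<open>simp add: numeral_2_eq_2\<close>)
    also have "frechet_derivative (\<lambda>y. ?h (frechet_derivative f (at y) v)) (at x) =
        frechet_derivative (\<lambda>y. frechet_derivative (\<lambda>z. ?h (f z)) (at y) v) (at x)"
      by (rule frechet_derivative_cong_open[OF assms(1,2)])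
        (simp add: frechet_derivative_bounded_linear[OF bl d])
    finally show ?thesis .
  qed
  then show "?h (frechet_derivative (\<lambda>y. frechet_derivative f (at y) v) (at x) w) =
    ?h (frechet_derivative (\<lambda>y. frechet_derivative f (at y) w) (at x) v)"
    using second_derivative_symmetric_real[OF assms(1,2) Ck_on_bounded_linear[OF bl assms(1) f]]
    by simp
qed

section \<open>Wirtinger calculus\<close>

text \<open>The real differential splits into a complex-linear and a conjugate-linear part, with the
  Wirtinger derivatives as coefficients. The proof expands \<open>v\<close> in the real basis
  \<open>axis i 1\<close>, \<open>axis i \<i>\<close>.\<close>

lemma frechet_derivative_wirtinger:
  fixes f :: "complex^'n::finite \<Rightarrow> complex"
  assumes "f differentiable (at x)"
  shows "frechet_derivative f (at x) v = (\<Sum>i\<in>UNIV. dz i f x * v $ i + dzbar i f x * cnj (v $ i))"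
proof -
  let ?D = "frechet_derivative f (at x)"
  have lin: "linear ?D"
    using assms by (rule linear_frechet_derivative)
  have "v = (\<Sum>i\<in>UNIV. Re (v $ i) *\<^sub>R axis i 1 + Im (v $ i) *\<^sub>R axis i \<i>)"
    by (simp add: vec_eq_iff axis_def complex_eq_iff if_distrib[of "\<lambda>t. _ * t"] if_distrib[of Re] if_distrib[of Im] cong: if_cong)
  then have "?D v = ?D (\<Sum>i\<in>UNIV. Re (v $ i) *\<^sub>R axis i 1 + Im (v $ i) *\<^sub>R axis i \<i>)"
    by simp
  also have "\<dots> = (\<Sum>i\<in>UNIV. Re (v $ i) *\<^sub>R ?D (axis i 1) + Im (v $ i) *\<^sub>R ?D (axis i \<i>))"
    by (simp add: linear_sum[OF lin] linear_add[OF lin] linear_cmul[OF lin])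
  also have "\<dots> = (\<Sum>i\<in>UNIV. dz i f x * v $ i + dzbar i f x * cnj (v $ i))"
    by (rule sum.cong) (simp_all add: dz_def dzbar_def complex_eq_iff field_simps)
  finally show ?thesis .
qed

lemma dz_cong_open:
  assumes "open S" "x \<in> S" "\<And>y. y \<in> S \<Longrightarrow> f y = g y"
  shows "dz i f x = dz i g x"
  unfolding dz_def by (simp add: frechet_derivative_cong_open[OF assms])

lemma dzbar_cong_open:
  assumes "open S" "x \<in> S" "\<And>y. y \<in> S \<Longrightarrow> f y = g y"
  shows "dzbar i f x = dzbar i g x"
  unfolding dzbar_def by (simp add: frechet_derivative_cong_open[OF assms])

lemma dz_const [simp]: "dz i (\<lambda>x. c) x = 0" and dzbar_const [simp]: "dzbar i (\<lambda>x. c) x = 0"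
  by (simp_all add: dz_def dzbar_def)

lemma dz_add:
  assumes "f differentiable (at x)" "g differentiable (at x)"
  shows "dz i (\<lambda>x. f x + g x) x = dz i f x + dz i g x"
    and dzbar_add: "dzbar i (\<lambda>x. f x + g x) x = dzbar i f x + dzbar i g x"
proof -
  have "((\<lambda>x. f x + g x) has_derivative
      (\<lambda>v. frechet_derivative f (at x) v + frechet_derivative g (at x) v)) (at x)"
    using assms by (intro has_derivative_add) (simp_all add: frechet_derivative_works)
  then have "frechet_derivative (\<lambda>x. f x + g x) (at x) =
      (\<lambda>v. frechet_derivative f (at x) v + frechet_derivative g (at x) v)"
    by (rule frechet_derivative_eq)
  then show "dz i (\<lambda>x. f x + g x) x = dz i f x + dz i g x"
    "dzbar i (\<lambda>x. f x + g x) x = dzbar i f x + dzbar i g x"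
    by (simp_all add: dz_def dzbar_def field_simps)
qed

lemma dz_sum:
  assumes "\<And>a. a \<in> I \<Longrightarrow> f a differentiable (at x)"
  shows "dz i (\<lambda>x. \<Sum>a\<in>I. f a x) x = (\<Sum>a\<in>I. dz i (f a) x)"
  using assms
  by (induction I rule: infinite_finite_induct) (simp_all add: dz_add)

lemma dzbar_sum:
  assumes "\<And>a. a \<in> I \<Longrightarrow> f a differentiable (at x)"
  shows "dzbar i (\<lambda>x. \<Sum>a\<in>I. f a x) x = (\<Sum>a\<in>I. dzbar i (f a) x)"
  using assms
  by (induction I rule: infinite_finite_induct) (simp_all add: dzbar_add)

lemma dz_mult:
  assumes "f differentiable (at x)" "g differentiable (at x)"
  shows "dz i (\<lambda>x. f x * g x) x = dz i f x * g x + f x * dz i g x"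
    and dzbar_mult: "dzbar i (\<lambda>x. f x * g x) x = dzbar i f x * g x + f x * dzbar i g x"
proof -
  have "((\<lambda>x. f x * g x) has_derivative
      (\<lambda>v. f x * frechet_derivative g (at x) v + frechet_derivative f (at x) v * g x)) (at x)"
    using assms by (intro has_derivative_mult) (simp_all add: frechet_derivative_works)
  then have "frechet_derivative (\<lambda>x. f x * g x) (at x) =
      (\<lambda>v. f x * frechet_derivative g (at x) v + frechet_derivative f (at x) v * g x)"
    by (rule frechet_derivative_eq)
  then show "dz i (\<lambda>x. f x * g x) x = dz i f x * g x + f x * dz i g x"
    "dzbar i (\<lambda>x. f x * g x) x = dzbar i f x * g x + f x * dzbar i g x"
    by (simp_all add: dz_def dzbar_def field_simps)
qed

lemma dz_cnj:
  assumes "f differentiable (at x)"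
  shows "dz i (\<lambda>x. cnj (f x)) x = cnj (dzbar i f x)"
  by (simp add: dz_def dzbar_def frechet_derivative_bounded_linear[OF bounded_linear_cnj assms])

lemma frechet_derivative_nth:
  assumes "F differentiable (at x)"
  shows "frechet_derivative F (at x) v $ k = frechet_derivative (\<lambda>y. F y $ k) (at x) v"
  using frechet_derivative_bounded_linear[OF bounded_linear_vec_nth assms] by simp

text \<open>For holomorphic \<open>F\<close> the conjugate derivatives vanish, so the derivatives along \<open>axis i 1\<close> and
  \<open>axis i \<i>\<close> are \<open>J\<close> and \<open>\<i> J\<close>.\<close>

lemma frechet_derivative_compose_holo:
  fixes F :: "complex^'n::finite \<Rightarrow> complex^'n" and f :: "complex^'n \<Rightarrow> complex"
  assumes "F differentiable (at x)" "\<And>i k. dzbar i (\<lambda>y. F y $ k) x = 0" "f differentiable (at (F x))"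
  shows "frechet_derivative (\<lambda>y. f (F y)) (at x) (axis i a) =
    (\<Sum>k\<in>UNIV. dz k f (F x) * (jacobian F x $ k $ i * a) + dzbar k f (F x) * cnj (jacobian F x $ k $ i * a))"
proof -
  have Fk: "(\<lambda>y. F y $ k) differentiable (at x)" for k
    using differentiable_compose[of "\<lambda>z. z $ k" F x UNIV] assms(1)
    by (simp add: bounded_linear_imp_differentiable bounded_linear_vec_nth)
  have D: "frechet_derivative F (at x) (axis i a) $ k = jacobian F x $ k $ i * a" for k
    by (simp add: frechet_derivative_nth assms(1) frechet_derivative_wirtinger[OF Fk] assms(2)
        jacobian_def axis_def if_distrib[of "\<lambda>t. _ * t"] cong: if_cong)
  have "(\<lambda>y. f (F y)) = f \<circ> F"
    by auto
  then have "frechet_derivative (\<lambda>y. f (F y)) (at x) (axis i a) =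
      frechet_derivative f (at (F x)) (frechet_derivative F (at x) (axis i a))"
    by (simp add: frechet_derivative_compose assms)
  also have "\<dots> = (\<Sum>k\<in>UNIV. dz k f (F x) * frechet_derivative F (at x) (axis i a) $ k
      + dzbar k f (F x) * cnj (frechet_derivative F (at x) (axis i a) $ k))"
    by (rule frechet_derivative_wirtinger[OF assms(3)])
  finally show ?thesis
    unfolding D .
qed

text \<open>In forming \<open>dz\<close> the conjugate terms for the directions 1 and
  \<open>\<i>\<close> cancel, in forming \<open>dzbar\<close> the unconjugated ones do; hence a
  holomorphic inner map produces no mixed terms.\<close>

lemma dz_compose_holo:
  fixes F :: "complex^'n::finite \<Rightarrow> complex^'n" and f :: "complex^'n \<Rightarrow> complex"
  assumes "F differentiable (at x)" "\<And>i k. dzbar i (\<lambda>y. F y $ k) x = 0" "f differentiable (at (F x))"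
  shows "dz i (\<lambda>y. f (F y)) x = (\<Sum>k\<in>UNIV. dz k f (F x) * jacobian F x $ k $ i)"
    and dzbar_compose_holo:
      "dzbar i (\<lambda>y. f (F y)) x = (\<Sum>k\<in>UNIV. dzbar k f (F x) * cnj (jacobian F x $ k $ i))"
  unfolding dz_def[of i "\<lambda>y. f (F y)"] dzbar_def[of i "\<lambda>y. f (F y)"]
    frechet_derivative_compose_holo[OF assms]
  by (simp_all add: sum_distrib_left sum_subtractf[symmetric] sum.distrib[symmetric] sum_divide_distrib)
    (auto intro!: sum.cong simp: algebra_simps)

lemma smooth_on_dz:
  assumes "open S" "smooth_on S f"
  shows "smooth_on S (dz i f)" and smooth_on_dzbar: "smooth_on S (dzbar i f)"
proof -
  have "smooth_on S (\<lambda>x. (1/2) * (frechet_derivative f (at x) (axis i 1)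
      + c * frechet_derivative f (at x) (axis i \<i>)))" for c
    by (intro smooth_on_mult smooth_on_add smooth_on_const smooth_on_frechet_derivative assms)
  from this[of "- \<i>"] this[of \<i>] show "smooth_on S (dz i f)" "smooth_on S (dzbar i f)"
    by (simp_all add: dz_def[abs_def] dzbar_def[abs_def])
qed

text \<open>Both operators are combinations with constant coefficients of directional derivatives,
  so the symmetry of second derivatives applies term by term.\<close>

lemma dzbar_dz_commute:
  fixes f :: "complex^'n::finite \<Rightarrow> complex"
  assumes "open S" "x \<in> S" "smooth_on S f"
  shows "dzbar j (dz i f) x = dz i (dzbar j f) x"
proof -
  let ?D = "\<lambda>v y. frechet_derivative f (at y) v"
  have d: "?D v differentiable (at x)" for v
    using smooth_on_imp_differentiable[OF smooth_on_frechet_derivative] assms by blast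
  have lc: "frechet_derivative (\<lambda>y. (?D v y + c * ?D w y) / 2) (at x) z =
      (frechet_derivative (?D v) (at x) z + c * frechet_derivative (?D w) (at x) z) / 2" for v w z c
  proof -
    have "((\<lambda>y. (?D v y + c * ?D w y) / 2) has_derivative
        (\<lambda>z. (frechet_derivative (?D v) (at x) z + c * frechet_derivative (?D w) (at x) z) / 2)) (at x)"
      using d by (auto intro!: derivative_eq_intros simp: frechet_derivative_works)
    then show ?thesis
      by (simp add: frechet_derivative_eq)
  qed
  have sym: "frechet_derivative (?D v) (at x) w = frechet_derivative (?D w) (at x) v" for v w
    by (rule second_derivative_symmetric[OF assms(1,2) smooth_on_imp_Ck_on[OF assms(3)]])
  have "dz i f = (\<lambda>y. (?D (axis i 1) y + (-\<i>) * ?D (axis i \<i>) y) / 2)"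
    "dzbar j f = (\<lambda>y. (?D (axis j 1) y + \<i> * ?D (axis j \<i>) y) / 2)"
    by (simp_all add: dz_def[abs_def] dzbar_def[abs_def])
  note eqs = this
  show ?thesis
    unfolding dz_def[of i "dzbar j f"] dzbar_def[of j "dz i f"]
    unfolding eqs lc
    by (simp add: sym[of "axis j 1"] sym[of "axis j \<i>"] field_simps)
qed

section \<open>Holomorphic maps and their Jacobians\<close>

lemma holo_map_on_differentiable: "holo_map_on S F \<Longrightarrow> x \<in> S \<Longrightarrow> F differentiable (at x)"
  unfolding holo_map_on_def using smooth_on_imp_differentiable by blast

lemma jacobian_cong_open:
  assumes "open S" "x \<in> S" "\<And>y. y \<in> S \<Longrightarrow> F y = G y"
  shows "jacobian F x = jacobian G x"
  unfolding jacobian_def vec_eq_iff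
  by (auto intro!: dz_cong_open[OF assms(1,2)] simp: assms(3))

lemma jacobian_compose:
  fixes F G :: "complex^'n::finite \<Rightarrow> complex^'n"
  assumes "holo_map_on S F" "x \<in> S" "holo_map_on T G" "F x \<in> T" "open T"
  shows "jacobian (\<lambda>y. G (F y)) x = jacobian G (F x) ** jacobian F x"
proof -
  have G: "(\<lambda>z. G z $ k) differentiable (at (F x))" for k
    using smooth_on_nth[OF assms(5)] assms(3,4) smooth_on_imp_differentiable
    unfolding holo_map_on_def by blast
  have F: "F differentiable (at x)" "\<And>i k. dzbar i (\<lambda>y. F y $ k) x = 0"
    using assms by (auto simp: holo_map_on_differentiable holo_map_on_def)
  show ?thesis
    unfolding vec_eq_iff matrix_matrix_mult_def
    by (auto simp: jacobian_def[of "\<lambda>y. G (F y)"] dz_compose_holo[OF F G] jacobian_def[of G])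
qed

lemma jacobian_id: "jacobian (\<lambda>y. y) x = (mat 1 :: complex^'n::finite^'n)"
proof -
  have "frechet_derivative (\<lambda>y :: complex^'n. y $ k) (at x) v = v $ k" for v k
    using frechet_derivative_bounded_linear[OF bounded_linear_vec_nth, of "\<lambda>y. y" x k] by simp
  then show ?thesis
    unfolding vec_eq_iff jacobian_def mat_def
    by (simp add: dz_def axis_def)
qed

lemma smooth_on_jacobian:
  assumes "open S" "holo_map_on S F"
  shows "smooth_on S (\<lambda>x. jacobian F x $ k $ i)"
  using smooth_on_dz(1)[OF assms(1) smooth_on_nth[OF assms(1)], of F i k] assms(2)
  by (simp add: jacobian_def holo_map_on_def)

text \<open>The entries of the Jacobian are holomorphic: the two Wirtinger operators commute, and
  \<open>dzbar j\<close> of the components of \<open>F\<close> vanishes on all of the open set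
  \<open>S\<close>, not just at \<open>x\<close>.\<close>

lemma dzbar_jacobian:
  assumes "open S" "holo_map_on S F" "x \<in> S"
  shows "dzbar j (\<lambda>y. jacobian F y $ k $ i) x = 0"
proof -
  have "dzbar j (dz i (\<lambda>y. F y $ k)) x = dz i (dzbar j (\<lambda>y. F y $ k)) x"
    using assms by (intro dzbar_dz_commute smooth_on_nth) (auto simp: holo_map_on_def)
  also have "\<dots> = dz i (\<lambda>y. 0) x"
    by (rule dz_cong_open[OF assms(1,3)]) (use assms in \<open>auto simp: holo_map_on_def\<close>)
  finally show ?thesis
    by (simp add: jacobian_def)
qed

section \<open>Matrix-valued functions\<close>

lemma matrix_inv_right:
  fixes M :: "'a::field^'n::finite^'n"
  assumes "invertible M"
  shows "M ** matrix_inv M = mat 1" and matrix_inv_left: "matrix_inv M ** M = mat 1"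
  using someI_ex[OF assms[unfolded invertible_def]] by (auto simp: matrix_inv_def)

lemma matrix_inv_eqI:
  fixes M :: "'a::field^'n::finite^'n"
  assumes "M ** N = mat 1"
  shows "matrix_inv M = N"
proof -
  have "invertible M"
    using assms invertible_right_inverse by blast
  then have "matrix_inv M ** (M ** N) = N"
    by (simp add: matrix_mul_assoc matrix_inv_left)
  then show ?thesis
    by (simp add: assms)
qed

lemma matrix_inv_mult:
  fixes M N :: "'a::field^'n::finite^'n"
  assumes "invertible M" "invertible N"
  shows "matrix_inv (M ** N) = matrix_inv N ** matrix_inv M"
proof (rule matrix_inv_eqI)
  have "M ** N ** (matrix_inv N ** matrix_inv M) = M ** (N ** matrix_inv N) ** matrix_inv M"
    by (simp add: matrix_mul_assoc)
  then show "M ** N ** (matrix_inv N ** matrix_inv M) = mat 1"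
    by (simp add: matrix_inv_right assms)
qed

lemma trace_conjugate:
  fixes A B C :: "'a::field^'n::finite^'n"
  assumes "invertible C"
  shows "trace (matrix_inv C ** A ** C) = trace A"
  by (metis assms matrix_inv_right(1) matrix_mul_assoc matrix_mul_rid trace_mul_sym)

lemma differentiable_prod_fun:
  fixes f :: "'i \<Rightarrow> 'a::real_normed_vector \<Rightarrow> 'b::real_normed_field"
  assumes "\<And>i. i \<in> I \<Longrightarrow> f i differentiable (at x)"
  shows "(\<lambda>y. \<Prod>i\<in>I. f i y) differentiable (at x)"
  using assms by (induction I rule: infinite_finite_induct) auto

lemma differentiable_det:
  fixes M :: "'a::real_normed_vector \<Rightarrow> 'b::real_normed_field^'n::finite^'n"
  assumes "\<And>k l. (\<lambda>y. M y $ k $ l) differentiable (at x)"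
  shows "(\<lambda>y. det (M y)) differentiable (at x)"
  unfolding det_def
  by (intro differentiable_sum differentiable_mult differentiable_prod_fun assms ballI) auto

text \<open>Entries of the inverse are quotients of determinants by Cramer's rule.\<close>

lemma differentiable_matrix_inv:
  fixes M :: "'a::real_normed_vector \<Rightarrow> 'b::real_normed_field^'n::finite^'n"
  assumes M: "\<And>k l. (\<lambda>y. M y $ k $ l) differentiable (at x)"
    and S: "open S" "x \<in> S" and inv: "\<And>y. y \<in> S \<Longrightarrow> invertible (M y)"
  shows "(\<lambda>y. matrix_inv (M y) $ i $ j) differentiable (at x)"
proof -
  let ?B = "\<lambda>y. (\<chi> k l. if l = i then axis j 1 $ k else M y $ k $ l) :: 'b^'n^'n"
  have eq: "matrix_inv (M y) $ i $ j = det (?B y) / det (M y)" if "y \<in> S" for y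
  proof -
    have d: "det (M y) \<noteq> 0"
      using inv[OF that] by (simp add: invertible_det_nz)
    have "M y *v column j (matrix_inv (M y)) = axis j 1"
      using matrix_inv_right[OF inv[OF that]]
      by (simp add: vec_eq_iff matrix_vector_mult_def matrix_matrix_mult_def column_def mat_def axis_def)
    then have "column j (matrix_inv (M y)) =
        (\<chi> k. det (\<chi> i l. if l = k then axis j 1 $ i else M y $ i $ l) / det (M y))"
      using cramer[OF d] by blast
    then show ?thesis
      by (simp add: vec_eq_iff column_def)
  qed
  have B: "(\<lambda>y. ?B y $ k $ l) differentiable (at x)" for k l
    using M[of k l] by (cases "l = i") simp_all
  have "(\<lambda>y. det (?B y) / det (M y)) differentiable (at x)"
    using inv[OF S(2)]
    by (intro differentiable_divide differentiable_det B M) (simp add: invertible_det_nz)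
  then show ?thesis
    using differentiable_cong_open[OF S eq] by simp
qed

section \<open>Entrywise Wirtinger derivatives of matrix functions\<close>

definition dz_matrix :: "'n::finite \<Rightarrow> (complex^'n \<Rightarrow> complex^'n^'n) \<Rightarrow> complex^'n \<Rightarrow> complex^'n^'n" where
  "dz_matrix i M x = (\<chi> k l. dz i (\<lambda>y. M y $ k $ l) x)"

definition dzbar_matrix :: "'n::finite \<Rightarrow> (complex^'n \<Rightarrow> complex^'n^'n) \<Rightarrow> complex^'n \<Rightarrow> complex^'n^'n" where
  "dzbar_matrix i M x = (\<chi> k l. dzbar i (\<lambda>y. M y $ k $ l) x)"

lemma differentiable_matrix_mult:
  fixes M N :: "'a::real_normed_vector \<Rightarrow> complex^'n::finite^'n"
  assumes "\<And>k l. (\<lambda>y. M y $ k $ l) differentiable (at x)" "\<And>k l. (\<lambda>y. N y $ k $ l) differentiable (at x)"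
  shows "(\<lambda>y. (M y ** N y) $ k $ l) differentiable (at x)"
  using assms by (simp add: matrix_matrix_mult_def)

lemma dz_matrix_mult:
  assumes "\<And>k l. (\<lambda>y. M y $ k $ l) differentiable (at x)" "\<And>k l. (\<lambda>y. N y $ k $ l) differentiable (at x)"
  shows "dz_matrix i (\<lambda>y. M y ** N y) x = dz_matrix i M x ** N x + M x ** dz_matrix i N x"
    and dzbar_matrix_mult:
      "dzbar_matrix i (\<lambda>y. M y ** N y) x = dzbar_matrix i M x ** N x + M x ** dzbar_matrix i N x"
  unfolding vec_eq_iff dz_matrix_def dzbar_matrix_def matrix_matrix_mult_def
  using assms
  by (simp_all add: dz_sum dz_mult dzbar_sum sum.distrib)

lemma differentiable_trace:
  fixes M :: "'a::real_normed_vector \<Rightarrow> complex^'n::finite^'n"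
  assumes "\<And>k l. (\<lambda>y. M y $ k $ l) differentiable (at x)"
  shows "(\<lambda>y. trace (M y)) differentiable (at x)"
  using assms by (simp add: trace_def)

lemma dzbar_trace:
  assumes "\<And>k l. (\<lambda>y. M y $ k $ l) differentiable (at x)"
  shows "dzbar i (\<lambda>y. trace (M y)) x = trace (dzbar_matrix i M x)"
  unfolding trace_def dzbar_matrix_def by (simp add: dzbar_sum assms)

text \<open>Differentiating \<open>M ** matrix_inv M = mat 1\<close> leaves \<open>M x\<close> times
  the derivative of the inverse equal to 0, and \<open>M x\<close> can be cancelled. So inverses of
  holomorphic matrix functions are holomorphic.\<close>

lemma dzbar_matrix_inv:
  assumes M: "\<And>k l. (\<lambda>y. M y $ k $ l) differentiable (at x)"
    and S: "open S" "x \<in> S" and inv: "\<And>y. y \<in> S \<Longrightarrow> invertible (M y)"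
    and 0: "dzbar_matrix i M x = 0"
  shows "dzbar_matrix i (\<lambda>y. matrix_inv (M y)) x = 0"
proof -
  let ?D = "dzbar_matrix i (\<lambda>y. matrix_inv (M y)) x"
  have "dzbar i (\<lambda>y. (M y ** matrix_inv (M y)) $ k $ l) x = dzbar i (\<lambda>y. mat 1 $ k $ l) x" for k l
    by (rule dzbar_cong_open[OF S]) (simp add: matrix_inv_right inv)
  then have "dzbar_matrix i (\<lambda>y. M y ** matrix_inv (M y)) x = dzbar_matrix i (\<lambda>y. mat 1) x"
    unfolding dzbar_matrix_def by simp
  also have "\<dots> = 0"
    by (simp add: dzbar_matrix_def vec_eq_iff)
  finally have "M x ** ?D = 0"
    using dzbar_matrix_mult[OF M differentiable_matrix_inv[OF M S inv]] 0 by simp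
  then have "matrix_inv (M x) ** M x ** ?D = matrix_inv (M x) ** 0"
    by (simp flip: matrix_mul_assoc)
  then show ?thesis
    by (simp add: matrix_inv_left[OF inv[OF S(2)]])
qed

section \<open>Conjugate matrices and the pull-back as a congruence\<close>

definition conj_matrix :: "complex^'n^'m \<Rightarrow> complex^'n^'m" where
  "conj_matrix M = (\<chi> i j. cnj (M $ i $ j))"

lemma conj_matrix_mult: "conj_matrix (M ** N) = conj_matrix M ** conj_matrix N"
  by (simp add: conj_matrix_def matrix_matrix_mult_def vec_eq_iff)

lemma conj_matrix_mat_1: "conj_matrix (mat 1) = mat 1"
  by (simp add: conj_matrix_def mat_def vec_eq_iff)

lemma invertible_conj_matrix:
  fixes M :: "complex^'n::finite^'n"
  assumes "invertible M"
  shows "invertible (conj_matrix M)"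
  unfolding invertible_right_inverse
  by (metis assms conj_matrix_mat_1 conj_matrix_mult matrix_inv_right(1))

lemma invertible_transpose_matrix:
  fixes M :: "complex^'n::finite^'n"
  shows "invertible M \<Longrightarrow> invertible (transpose M)"
  by (simp add: invertible_det_nz)

text \<open>The index formula becomes a triple product, so that composition, inversion and traces of
  pull-backs are matrix algebra. The right factor is conjugated but not transposed, as its row index
  is the one contracted with \<open>H\<close>.\<close>

lemma pull_matrix_eq: "pull_matrix J H = transpose J ** H ** conj_matrix J"
proof -
  have "(\<Sum>k\<in>UNIV. \<Sum>l\<in>UNIV. J $ k $ i * cnj (J $ l $ j) * H $ k $ l) =
      (\<Sum>l\<in>UNIV. (\<Sum>k\<in>UNIV. J $ k $ i * H $ k $ l) * cnj (J $ l $ j))" for i j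
    by (subst sum.swap) (simp add: sum_distrib_left sum_distrib_right mult_ac)
  then show ?thesis
    by (simp add: vec_eq_iff pull_matrix_def matrix_matrix_mult_def transpose_def conj_matrix_def)
qed

text \<open>Contravariance: \<open>J ** K\<close> is the Jacobian of a composite whose inner map has
  Jacobian \<open>K\<close>, so \<open>J\<close> pulls back first.\<close>

lemma pull_matrix_mult: "pull_matrix (J ** K) H = pull_matrix K (pull_matrix J H)"
  by (simp add: pull_matrix_eq matrix_transpose_mul conj_matrix_mult matrix_mul_assoc)

lemma pull_matrix_mat_1: "pull_matrix (mat 1) H = H"
  by (simp add: pull_matrix_eq conj_matrix_mat_1)

section \<open>The Chern scalar curvature in a chart\<close>

text \<open>The trace of the connection matrix. For differentiable invertible \<open>H\<close>,
  Jacobi's formula identifies it with the logarithmic derivative of \<open>det (H x)\<close>; the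
  trace form avoids both the logarithm and the derivative of a determinant.\<close>

definition chern_trace :: "(complex^'n \<Rightarrow> complex^'n^'n) \<Rightarrow> complex^'n \<Rightarrow> 'n::finite \<Rightarrow> complex" where
  "chern_trace H x i = trace (matrix_inv (H x) ** dz_matrix i H x)"

lemma chern_trace_eq: "chern_trace H x i = (\<Sum>p\<in>UNIV. chern_christoffel H x p i p)"
  unfolding chern_trace_def trace_def chern_christoffel_def matrix_matrix_mult_def dz_matrix_def upper_def
  by simp (rule sum.swap)

lemma smooth_on_entry: "open S \<Longrightarrow> smooth_on S H \<Longrightarrow> smooth_on S (\<lambda>y. H y $ k $ l)"
  by (intro smooth_on_nth)

lemma differentiable_chern_christoffel:
  assumes "open S" "x \<in> S" "smooth_on S H" "\<And>y. y \<in> S \<Longrightarrow> invertible (H y)"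
  shows "(\<lambda>y. chern_christoffel H y p i k) differentiable (at x)"
proof -
  have H: "smooth_on S (\<lambda>y. H y $ k $ l)" for k l
    by (intro smooth_on_entry assms)
  show ?thesis
    unfolding chern_christoffel_def upper_def
    by (intro differentiable_sum differentiable_mult ballI finite
        differentiable_matrix_inv[OF smooth_on_imp_differentiable[OF H assms(2)] assms(1,2,4)]
        smooth_on_imp_differentiable[OF smooth_on_dz(1)[OF assms(1) H] assms(2)])
qed

lemma differentiable_chern_trace:
  assumes "open S" "x \<in> S" "smooth_on S H" "\<And>y. y \<in> S \<Longrightarrow> invertible (H y)"
  shows "(\<lambda>y. chern_trace H y i) differentiable (at x)"
  unfolding chern_trace_eq
  by (intro differentiable_sum ballI finite differentiable_chern_christoffel[OF assms])

text \<open>The metric factor in \<open>chern_curv\<close> cancels against the inverse metric, so that only the trace of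
  the connection form matters for the Ricci form.\<close>

lemma chern_ricci_eq:
  assumes "open S" "x \<in> S" "smooth_on S H" "\<And>y. y \<in> S \<Longrightarrow> invertible (H y)"
  shows "chern_ricci H x i j = - dzbar j (\<lambda>y. chern_trace H y i) x"
proof -
  let ?G = "\<lambda>p k. dzbar j (\<lambda>y. chern_christoffel H y p i k) x"
  have inv: "(\<Sum>l\<in>UNIV. upper (H x) k l * H x $ p $ l) = (if p = k then 1 else 0)" for k p
    using matrix_inv_right[OF assms(4)[OF assms(2)]]
    by (simp add: vec_eq_iff matrix_matrix_mult_def mat_def upper_def mult.commute)
  have "chern_ricci H x i j = (\<Sum>k\<in>UNIV. \<Sum>l\<in>UNIV. \<Sum>p\<in>UNIV. - ?G p k * (upper (H x) k l * H x $ p $ l))"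
    unfolding chern_ricci_def chern_curv_def by (simp add: sum_distrib_left mult_ac)
  also have "\<dots> = (\<Sum>k\<in>UNIV. \<Sum>p\<in>UNIV. - ?G p k * (\<Sum>l\<in>UNIV. upper (H x) k l * H x $ p $ l))"
    by (subst sum.swap) (simp add: sum_distrib_left)
  also have "\<dots> = (\<Sum>k\<in>UNIV. - ?G k k)"
    unfolding inv by (simp add: if_distrib[of "\<lambda>t. _ * t"] cong: if_cong)
  also have "\<dots> = - dzbar j (\<lambda>y. chern_trace H y i) x"
    unfolding chern_trace_eq
    by (simp add: dzbar_sum differentiable_chern_christoffel[OF assms] sum_negf)
  finally show ?thesis .
qed

lemma chern_scalar_local_eq:
  "chern_scalar_local H x = trace (matrix_inv (H x) ** (\<chi> i j. chern_ricci H x i j))"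
  unfolding chern_scalar_local_def trace_def matrix_matrix_mult_def upper_def
  by simp (rule sum.swap)

lemma invertible_pull_matrix:
  "invertible J \<Longrightarrow> invertible H \<Longrightarrow> invertible (pull_matrix J H)"
  unfolding pull_matrix_eq
  by (intro invertible_mult invertible_transpose_matrix invertible_conj_matrix)

text \<open>The metric trace of a (1,1)-tensor does not depend on coordinates:
  \<open>transpose J\<close> cancels against its inverse in the middle, and the outer
  \<open>conj_matrix J\<close> cancels by cyclicity of the trace.\<close>

lemma trace_pull_matrix:
  fixes J H R :: "complex^'n::finite^'n"
  assumes "invertible J" "invertible H"
  shows "trace (matrix_inv (pull_matrix J H) ** pull_matrix J R) = trace (matrix_inv H ** R)"
proof -
  have i: "invertible (transpose J)" "invertible (conj_matrix J)"
    using assms by (auto intro: invertible_transpose_matrix invertible_conj_matrix)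
  have "matrix_inv (pull_matrix J H) ** pull_matrix J R =
      matrix_inv (conj_matrix J) ** matrix_inv H ** (matrix_inv (transpose J) ** transpose J) ** R ** conj_matrix J"
    unfolding pull_matrix_eq
    by (simp add: matrix_inv_mult invertible_mult i assms matrix_mul_assoc)
  also have "\<dots> = matrix_inv (conj_matrix J) ** (matrix_inv H ** R) ** conj_matrix J"
    by (simp add: matrix_inv_left i matrix_mul_assoc)
  finally show ?thesis
    by (simp add: trace_conjugate i)
qed


text \<open>The connection trace of \<open>H\<close> is that of \<open>K\<close>, transformed as a
  covector, plus the logarithmic derivative \<open>trace (?L i y)\<close> of the Jacobian. The
  latter is holomorphic and disappears under \<open>dzbar\<close>, so the Ricci tensors are related
  by \<open>pull_matrix\<close> and their metric traces agree.\<close>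

theorem chern_scalar_local_pull_matrix:
  fixes F :: "complex^'n::finite \<Rightarrow> complex^'n" and H K :: "complex^'n \<Rightarrow> complex^'n^'n"
  assumes U: "open U" "x \<in> U" and V: "open V" and FU: "\<And>y. y \<in> U \<Longrightarrow> F y \<in> V"
    and F: "holo_map_on U F" and J: "\<And>y. y \<in> U \<Longrightarrow> invertible (jacobian F y)"
    and K: "smooth_on V K" "\<And>z. z \<in> V \<Longrightarrow> invertible (K z)"
    and H: "smooth_on U H" "\<And>y. y \<in> U \<Longrightarrow> H y = pull_matrix (jacobian F y) (K (F y))"
  shows "chern_scalar_local H x = chern_scalar_local K (F x)"
proof -
  let ?J = "jacobian F"
  let ?Jt = "\<lambda>y. transpose (?J y)"
  let ?L = "\<lambda>i y. matrix_inv (?Jt y) ** dz_matrix i ?Jt y"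
  have Fd: "F differentiable (at y)" "\<And>i k. dzbar i (\<lambda>y. F y $ k) y = 0" if "y \<in> U" for y
    using F that by (auto simp: holo_map_on_differentiable holo_map_on_def)
  have J_smooth: "smooth_on U (\<lambda>y. ?Jt y $ k $ l)" for k l
    using smooth_on_jacobian[OF U(1) F] by (simp add: transpose_def)
  have Jt_diff: "(\<lambda>y. ?Jt y $ k $ l) differentiable (at y)" if "y \<in> U" for k l y
    using smooth_on_imp_differentiable[OF J_smooth that] .
  have J_diff: "(\<lambda>y. ?J y $ k $ l) differentiable (at y)" if "y \<in> U" for k l y
    using Jt_diff[OF that, of l k] by (simp add: transpose_def)
  have Jc_diff: "(\<lambda>y. conj_matrix (?J y) $ k $ l) differentiable (at y)" if "y \<in> U" for k l y
    using differentiable_compose[of cnj "\<lambda>y. ?J y $ k $ l" y UNIV] J_diff[OF that, of k l]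
    by (simp add: conj_matrix_def bounded_linear_imp_differentiable bounded_linear_cnj)
  have Jt_inv: "invertible (?Jt y)" "invertible (conj_matrix (?J y))" if "y \<in> U" for y
    using J[OF that] by (auto intro: invertible_transpose_matrix invertible_conj_matrix)
  have K_diff: "(\<lambda>z. K z $ k $ l) differentiable (at (F y))" if "y \<in> U" for k l y
    using smooth_on_imp_differentiable[OF smooth_on_entry[OF V K(1)] FU[OF that]] .
  have KF_diff: "(\<lambda>y. K (F y) $ k $ l) differentiable (at y)" if "y \<in> U" for k l y
    using differentiable_compose[of "\<lambda>z. K z $ k $ l" F y UNIV] K_diff[OF that] Fd[OF that] by simp
  \<comment> \<open>Conjugates of holomorphic entries are killed by \<open>dz\<close>, which removes
    one of the three terms of the product rule for \<open>H\<close>.\<close>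
  have dzJc: "dz_matrix i (\<lambda>y. conj_matrix (?J y)) y = 0" if "y \<in> U" for i y
    by (simp add: dz_matrix_def vec_eq_iff conj_matrix_def dz_cnj J_diff[OF that]
        dzbar_jacobian[OF U(1) F that])
  \<comment> \<open>The chain rule puts a factor \<open>?J y $ c $ i\<close> before each derivative
    of \<open>K\<close>; what remains is to move the sum over \<open>c\<close> outermost.\<close>
  have trace_dzKF: "trace (matrix_inv (K (F y)) ** dz_matrix i (\<lambda>y. K (F y)) y) =
      (\<Sum>c\<in>UNIV. ?J y $ c $ i * chern_trace K (F y) c)" if "y \<in> U" for i y
  proof -
    have "trace (matrix_inv (K (F y)) ** dz_matrix i (\<lambda>y. K (F y)) y) =
        (\<Sum>k\<in>UNIV. \<Sum>l\<in>UNIV. \<Sum>c\<in>UNIV.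
          ?J y $ c $ i * (matrix_inv (K (F y)) $ k $ l * dz c (\<lambda>z. K z $ l $ k) (F y)))"
      by (simp add: trace_def matrix_matrix_mult_def dz_matrix_def
          dz_compose_holo[OF Fd[OF that] K_diff[OF that]] sum_distrib_left mult_ac)
    also have "\<dots> = (\<Sum>k\<in>UNIV. \<Sum>c\<in>UNIV. \<Sum>l\<in>UNIV.
          ?J y $ c $ i * (matrix_inv (K (F y)) $ k $ l * dz c (\<lambda>z. K z $ l $ k) (F y)))"
      by (rule sum.cong[OF refl]) (rule sum.swap)
    also have "\<dots> = (\<Sum>c\<in>UNIV. \<Sum>k\<in>UNIV. \<Sum>l\<in>UNIV.
          ?J y $ c $ i * (matrix_inv (K (F y)) $ k $ l * dz c (\<lambda>z. K z $ l $ k) (F y)))"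
      by (rule sum.swap)
    also have "\<dots> = (\<Sum>c\<in>UNIV. ?J y $ c $ i * chern_trace K (F y) c)"
      by (simp add: chern_trace_def trace_def matrix_matrix_mult_def dz_matrix_def sum_distrib_left)
    finally show ?thesis .
  qed
  have H_eq: "H y = ?Jt y ** K (F y) ** conj_matrix (?J y)" if "y \<in> U" for y
    using H(2)[OF that] by (simp add: pull_matrix_eq)
  have H_inv: "invertible (H y)" if "y \<in> U" for y
    using H(2)[OF that] invertible_pull_matrix[OF J[OF that] K(2)[OF FU[OF that]]] by simp
  have tr: "chern_trace H y i = trace (?L i y) + (\<Sum>c\<in>UNIV. ?J y $ c $ i * chern_trace K (F y) c)"
    if y: "y \<in> U" for i y
  proof -
    note inv = Jt_inv[OF y] K(2)[OF FU[OF y]]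
    have "dz_matrix i H y = dz_matrix i (\<lambda>y. ?Jt y ** K (F y) ** conj_matrix (?J y)) y"
      unfolding dz_matrix_def vec_eq_iff
      by (auto intro!: dz_cong_open[OF U(1) y] simp: H_eq)
    also have "\<dots> = (dz_matrix i ?Jt y ** K (F y) + ?Jt y ** dz_matrix i (\<lambda>y. K (F y)) y) ** conj_matrix (?J y)"
      by (simp add: dz_matrix_mult differentiable_matrix_mult Jt_diff[OF y] KF_diff[OF y] Jc_diff[OF y] dzJc[OF y])
    finally have dzH: "dz_matrix i H y = \<dots>" .
    have "matrix_inv (H y) ** dz_matrix i H y =
        matrix_inv (conj_matrix (?J y)) ** (matrix_inv (K (F y)) ** matrix_inv (?Jt y) **
          (dz_matrix i ?Jt y ** K (F y) + ?Jt y ** dz_matrix i (\<lambda>y. K (F y)) y)) ** conj_matrix (?J y)"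
      unfolding dzH H_eq[OF y]
      by (simp add: matrix_inv_mult invertible_mult inv matrix_mul_assoc)
    \<comment> \<open>The conjugated Jacobian and its inverse now stand on the outer sides and drop
      out of the trace.\<close>
    then have "chern_trace H y i = trace (matrix_inv (K (F y)) ** matrix_inv (?Jt y) **
          (dz_matrix i ?Jt y ** K (F y) + ?Jt y ** dz_matrix i (\<lambda>y. K (F y)) y))"
      by (simp add: chern_trace_def trace_conjugate inv)
    also have "\<dots> = trace (matrix_inv (K (F y)) ** ?L i y ** K (F y)) +
        trace (matrix_inv (K (F y)) ** (matrix_inv (?Jt y) ** ?Jt y) ** dz_matrix i (\<lambda>y. K (F y)) y)"
      by (simp add: matrix_add_ldistrib trace_add matrix_mul_assoc)
    also have "\<dots> = trace (?L i y) + (\<Sum>c\<in>UNIV. ?J y $ c $ i * chern_trace K (F y) c)"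
      by (simp add: trace_conjugate matrix_inv_left inv trace_dzKF[OF y])
    finally show ?thesis .
  qed
  have dzJt: "smooth_on U (\<lambda>y. dz_matrix i ?Jt y $ k $ l)" for i k l
    using smooth_on_dz(1)[OF U(1) J_smooth] by (simp add: dz_matrix_def)
  have Jti_diff: "(\<lambda>y. matrix_inv (?Jt y) $ k $ l) differentiable (at x)" for k l
    by (rule differentiable_matrix_inv[OF Jt_diff[OF U(2)] U Jt_inv(1)])
  note L_diff = Jti_diff smooth_on_imp_differentiable[OF dzJt U(2)]
  \<comment> \<open>Holomorphy of the correction term: the inverse Jacobian and the derivative of
    the Jacobian both have vanishing \<open>dzbar\<close>.\<close>
  have L: "dzbar j (\<lambda>y. trace (?L i y)) x = 0" for i j
  proof -
    have "dzbar_matrix j (\<lambda>y. matrix_inv (?Jt y)) x = 0"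
    proof (rule dzbar_matrix_inv[OF Jt_diff[OF U(2)] U Jt_inv(1)])
      show "dzbar_matrix j ?Jt x = 0"
        by (simp add: dzbar_matrix_def transpose_def vec_eq_iff dzbar_jacobian[OF U(1) F U(2)])
    qed
    moreover have "dzbar j (dz i (\<lambda>y. ?Jt y $ k $ l)) x = 0" for k l
    proof -
      have "dzbar j (dz i (\<lambda>y. ?Jt y $ k $ l)) x = dz i (dzbar j (\<lambda>y. ?Jt y $ k $ l)) x"
        by (rule dzbar_dz_commute[OF U J_smooth])
      also have "\<dots> = dz i (\<lambda>y. 0) x"
        by (rule dz_cong_open[OF U]) (simp add: transpose_def dzbar_jacobian[OF U(1) F])
      finally show ?thesis
        by simp
    qed
    then have "dzbar_matrix j (\<lambda>y. dz_matrix i ?Jt y) x = 0"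
      by (simp add: dzbar_matrix_def dz_matrix_def vec_eq_iff)
    ultimately have "dzbar_matrix j (?L i) x = 0"
      by (simp add: dzbar_matrix_mult L_diff)
    then show ?thesis
      by (simp add: dzbar_trace differentiable_matrix_mult L_diff trace_def[of 0])
  qed
  have TK_diff: "(\<lambda>z. chern_trace K z c) differentiable (at (F x))" for c
    by (rule differentiable_chern_trace[OF V FU[OF U(2)] K])
  have TKF_diff: "(\<lambda>y. chern_trace K (F y) c) differentiable (at x)" for c
    using differentiable_compose[of "\<lambda>z. chern_trace K z c" F x UNIV] TK_diff Fd[OF U(2)] by simp
  have ricci: "chern_ricci H x i j = pull_matrix (?J x) (\<chi> i j. chern_ricci K (F x) i j) $ i $ j" for i j
  proof -
    have "dzbar j (\<lambda>y. chern_trace H y i) x =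
        dzbar j (\<lambda>y. trace (?L i y) + (\<Sum>c\<in>UNIV. ?J y $ c $ i * chern_trace K (F y) c)) x"
      by (rule dzbar_cong_open[OF U tr])
    \<comment> \<open>The correction drops out by \<open>L\<close>; in the next step
      \<open>?J y $ c $ i\<close> behaves like a constant because it is holomorphic.\<close>
    also have "\<dots> = (\<Sum>c\<in>UNIV. dzbar j (\<lambda>y. ?J y $ c $ i * chern_trace K (F y) c) x)"
      unfolding dzbar_add[OF differentiable_trace[OF differentiable_matrix_mult[OF L_diff]]
          differentiable_sum[OF finite ballI[OF differentiable_mult[OF J_diff[OF U(2)] TKF_diff]]]] L
      by (simp add: dzbar_sum J_diff[OF U(2)] TKF_diff)
    also have "\<dots> = (\<Sum>c\<in>UNIV. ?J x $ c $ i *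
        (\<Sum>b\<in>UNIV. dzbar b (\<lambda>z. chern_trace K z c) (F x) * cnj (?J x $ b $ j)))"
      by (simp add: dzbar_mult J_diff[OF U(2)] TKF_diff dzbar_jacobian[OF U(1) F U(2)]
          dzbar_compose_holo[OF Fd[OF U(2)] TK_diff])
    finally have "dzbar j (\<lambda>y. chern_trace H y i) x = \<dots>" .
    moreover have "chern_ricci H x i j = - dzbar j (\<lambda>y. chern_trace H y i) x"
      by (rule chern_ricci_eq[OF U H(1) H_inv])
    moreover have "chern_ricci K (F x) i j = - dzbar j (\<lambda>z. chern_trace K z i) (F x)" for i j
      by (rule chern_ricci_eq[OF V FU[OF U(2)] K])
    ultimately show ?thesis
      by (simp add: pull_matrix_def sum_distrib_left sum_negf mult_ac)
  qed
  have "(\<chi> i j. chern_ricci H x i j) = pull_matrix (?J x) (\<chi> i j. chern_ricci K (F x) i j)"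
    by (simp add: vec_eq_iff ricci)
  then show ?thesis
    unfolding chern_scalar_local_eq
    by (simp add: H(2)[OF U(2)] trace_pull_matrix J[OF U(2)] K(2)[OF FU[OF U(2)]])
qed

text \<open>In the connection trace the factors \<open>exp (f y)\<close> and
  \<open>exp (- f y)\<close> cancel, leaving an extra derivative of \<open>f\<close> multiplied by
  \<open>n\<close>, the trace of the identity. The surviving factor \<open>exp (- f x)\<close> comes
  from the inverse metric in the final contraction.\<close>

theorem chern_scalar_local_conformal:
  fixes H :: "complex^'n::finite \<Rightarrow> complex^'n^'n" and f :: "complex^'n \<Rightarrow> real"
  assumes U: "open U" "x \<in> U" and f: "smooth_on U f"
    and H: "smooth_on U H" "\<And>y. y \<in> U \<Longrightarrow> invertible (H y)"
  shows "chern_scalar_local (\<lambda>y. exp (f y) *\<^sub>R H y) x =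
    exp (- f x) *\<^sub>R (chern_scalar_local H x - of_nat CARD('n) *
      (\<Sum>i\<in>UNIV. \<Sum>j\<in>UNIV. upper (H x) i j * dz i (dzbar j (\<lambda>y. of_real (f y))) x))"
proof -
  let ?H = "\<lambda>y. exp (f y) *\<^sub>R H y"
  let ?f = "\<lambda>y. of_real (f y) :: complex"
  have fc: "smooth_on U ?f"
    by (rule smooth_on_bounded_linear[OF bounded_linear_of_real U(1) f])
  have inv_eq: "matrix_inv (?H y) = exp (- f y) *\<^sub>R matrix_inv (H y)" if "y \<in> U" for y
    by (rule matrix_inv_eqI)
      (simp add: matrix_scalar_ac matrix_inv_right H(2) that exp_minus)
  have H_inv: "invertible (?H y)" if "y \<in> U" for y
    unfolding invertible_right_inverse
    by (rule exI[of _ "exp (- f y) *\<^sub>R matrix_inv (H y)"])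
      (simp add: matrix_scalar_ac matrix_inv_right H(2) that exp_minus)
  have H_smooth: "smooth_on U ?H"
    by (intro smooth_on_scaleR smooth_on_exp U(1) f H(1))
  have H_diff: "(\<lambda>y. H y $ k $ l) differentiable (at y)" if "y \<in> U" for k l y
    using smooth_on_imp_differentiable[OF smooth_on_entry[OF U(1) H(1)] that] .
  have f_diff: "?f differentiable (at y)" if "y \<in> U" for y
    using smooth_on_imp_differentiable[OF fc that] .
  \<comment> \<open>A complex-valued copy of the conformal factor, since \<open>dz\<close> acts on
    complex-valued functions.\<close>
  let ?E = "\<lambda>y. of_real (exp (f y)) :: complex"
  have dE: "?E differentiable (at y)" "dz i ?E y = ?E y * dz i ?f y" if "y \<in> U" for y i
  proof -
    have fy: "f differentiable (at y)"
      using smooth_on_imp_differentiable[OF f that] .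
    then have "(f has_derivative frechet_derivative f (at y)) (at y)"
      by (simp add: frechet_derivative_works)
    then have "((\<lambda>y. exp (f y)) has_derivative (\<lambda>v. frechet_derivative f (at y) v * exp (f y))) (at y)"
      by (auto intro!: derivative_eq_intros)
    then have E: "(?E has_derivative (\<lambda>v. of_real (frechet_derivative f (at y) v * exp (f y)))) (at y)"
      by (rule bounded_linear.has_derivative[OF bounded_linear_of_real])
    then show "?E differentiable (at y)"
      by (auto simp: differentiable_def)
    show "dz i ?E y = ?E y * dz i ?f y"
      by (simp add: dz_def frechet_derivative_eq[OF E]
          frechet_derivative_bounded_linear[OF bounded_linear_of_real fy] field_simps)
  qed
  have tr: "chern_trace ?H y i = chern_trace H y i + of_nat CARD('n) * dz i ?f y" if y: "y \<in> U" for y i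
  proof -
    have "dz_matrix i ?H y = exp (f y) *\<^sub>R (dz_matrix i H y + (\<chi> k l. dz i ?f y * H y $ k $ l))"
    proof -
      have "dz i (\<lambda>y. ?E y * H y $ k $ l) y = ?E y * (dz i (\<lambda>y. H y $ k $ l) y + dz i ?f y * H y $ k $ l)" for k l
        by (simp add: dz_mult dE[OF y] H_diff[OF y] algebra_simps)
      then show ?thesis
        by (simp add: dz_matrix_def vec_eq_iff scaleR_conv_of_real[where 'a=complex])
    qed
    then have "chern_trace ?H y i = trace (matrix_inv (H y) **
        (dz_matrix i H y + (\<chi> k l. dz i ?f y * H y $ k $ l)))"
      by (simp add: chern_trace_def inv_eq[OF y] matrix_scalar_ac exp_minus)
    also have "\<dots> = chern_trace H y i + trace (matrix_inv (H y) ** (\<chi> k l. dz i ?f y * H y $ k $ l))"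
      by (simp add: matrix_add_ldistrib trace_add chern_trace_def)
    also have "trace (matrix_inv (H y) ** (\<chi> k l. dz i ?f y * H y $ k $ l)) =
        dz i ?f y * trace (matrix_inv (H y) ** H y)"
      by (simp add: trace_def matrix_matrix_mult_def sum_distrib_left mult_ac)
    also have "\<dots> = of_nat CARD('n) * dz i ?f y"
      by (simp add: matrix_inv_left[OF H(2)[OF y]] trace_I)
    finally show ?thesis .
  qed
  have ricci: "chern_ricci ?H x i j = chern_ricci H x i j - of_nat CARD('n) * dz i (dzbar j ?f) x" for i j
  proof -
    have dd: "dz i ?f differentiable (at x)"
      using smooth_on_imp_differentiable[OF smooth_on_dz(1)[OF U(1) fc] U(2)] .
    have "dzbar j (\<lambda>y. chern_trace ?H y i) x =
        dzbar j (\<lambda>y. chern_trace H y i + of_nat CARD('n) * dz i ?f y) x"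
      by (rule dzbar_cong_open[OF U tr])
    also have "\<dots> = dzbar j (\<lambda>y. chern_trace H y i) x + of_nat CARD('n) * dzbar j (dz i ?f) x"
      by (simp add: dzbar_add dzbar_mult differentiable_chern_trace[OF U H] dd)
    finally have "dzbar j (\<lambda>y. chern_trace ?H y i) x =
        dzbar j (\<lambda>y. chern_trace H y i) x + of_nat CARD('n) * dzbar j (dz i ?f) x" .
    moreover have "chern_ricci ?H x i j = - dzbar j (\<lambda>y. chern_trace ?H y i) x"
      by (rule chern_ricci_eq[OF U H_smooth H_inv])
    moreover have "chern_ricci H x i j = - dzbar j (\<lambda>y. chern_trace H y i) x"
      by (rule chern_ricci_eq[OF U H])
    \<comment> \<open>The curvature yields \<open>dzbar j\<close> applied after \<open>dz i\<close>,
      while the Laplacian is written in the opposite order.\<close>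
    ultimately show ?thesis
      by (simp add: dzbar_dz_commute[OF U fc])
  qed
  show ?thesis
    unfolding chern_scalar_local_def ricci
    by (simp add: upper_def inv_eq[OF U(2)] right_diff_distrib sum_subtractf sum_distrib_left
        scaleR_right.sum scaleR_right_diff_distrib mult_ac)
qed

section \<open>Charts and holomorphic self-maps\<close>

lemma atlas_chart:
  assumes "complex_atlas A" "c \<in> A"
  shows open_cdom: "open (cdom c)" and open_cimg: "open (cimg c)"
    and cinv_coord: "p \<in> cdom c \<Longrightarrow> cinv c (coord c p) = p"
    and coord_cinv: "x \<in> cimg c \<Longrightarrow> coord c (cinv c x) = x"
    and cinv_in: "x \<in> cimg c \<Longrightarrow> cinv c x \<in> cdom c"
    and coord_in: "p \<in> cdom c \<Longrightarrow> coord c p \<in> cimg c"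
    and continuous_cinv: "continuous_on (cimg c) (cinv c)"
proof -
  have h: "homeomorphism (cdom c) (cimg c) (coord c) (cinv c)" "open (cdom c)" "open (cimg c)"
    using assms by (auto simp: complex_atlas_def)
  show "open (cdom c)" "open (cimg c)" "continuous_on (cimg c) (cinv c)"
    "p \<in> cdom c \<Longrightarrow> cinv c (coord c p) = p" "x \<in> cimg c \<Longrightarrow> coord c (cinv c x) = x"
    "x \<in> cimg c \<Longrightarrow> cinv c x \<in> cdom c" "p \<in> cdom c \<Longrightarrow> coord c p \<in> cimg c"
    using h by (auto simp: homeomorphism_def)
qed

lemma chart_at_in:
  assumes "complex_atlas A"
  shows "chart_at A p \<in> A" and in_chart_at: "p \<in> cdom (chart_at A p)"
proof -
  have "\<exists>c. c \<in> A \<and> p \<in> cdom c"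
    using assms unfolding complex_atlas_def by (metis UNIV_I UN_iff)
  from someI_ex[OF this] show "chart_at A p \<in> A" "p \<in> cdom (chart_at A p)"
    by (auto simp: chart_at_def)
qed

text \<open>Within \<open>cimg c\<close> the image is the preimage of \<open>V\<close> under the
  continuous map \<open>cinv c\<close>.\<close>

lemma open_coord_image:
  assumes "complex_atlas A" "c \<in> A" "open V" "V \<subseteq> cdom c"
  shows "open (coord c ` V)"
proof -
  have "coord c ` V = cimg c \<inter> cinv c -` V"
    using assms(4) cinv_coord[OF assms(1,2)] coord_cinv[OF assms(1,2)] coord_in[OF assms(1,2)]
    by (force simp: image_iff)
  then show ?thesis
    using continuous_open_preimage[OF continuous_cinv[OF assms(1,2)] open_cimg[OF assms(1,2)] assms(3)]
    by simp
qed

section \<open>Holomorphic self-maps and their local Jacobians\<close>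

text \<open>Compatibility of the charts is precisely the local holomorphy condition for
  \<open>id\<close>. Transition maps thereby become a special case of self-maps and share the same
  chain rule.\<close>

lemma holo_self_map_id: "complex_atlas A \<Longrightarrow> holo_self_map A id"
  by (auto simp: holo_self_map_def complex_atlas_def)

lemma holo_self_map_continuous: "holo_self_map A \<phi> \<Longrightarrow> continuous_on UNIV \<phi>"
  by (simp add: holo_self_map_def)

abbreviation local_dom where
  "local_dom c c' \<phi> \<equiv> coord c ` (cdom c \<inter> \<phi> -` cdom c')"

lemma holo_self_map_local:
  "holo_self_map A \<phi> \<Longrightarrow> c \<in> A \<Longrightarrow> c' \<in> A \<Longrightarrow>
    holo_map_on (local_dom c c' \<phi>) (coord c' \<circ> \<phi> \<circ> cinv c)"
  by (simp add: holo_self_map_def)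

lemma open_local_dom:
  assumes "complex_atlas A" "holo_self_map A \<phi>" "c \<in> A" "c' \<in> A"
  shows "open (local_dom c c' \<phi>)"
  by (intro open_coord_image[OF assms(1,3)] open_Int open_vimage[OF _ holo_self_map_continuous[OF assms(2)]]
      open_cdom[OF assms(1,3)] open_cdom[OF assms(1,4)] Int_lower1)

lemma local_dom_iff:
  assumes "complex_atlas A" "c \<in> A"
  shows "x \<in> local_dom c c' \<phi> \<longleftrightarrow> x \<in> cimg c \<and> \<phi> (cinv c x) \<in> cdom c'"
  using cinv_coord[OF assms] coord_cinv[OF assms] coord_in[OF assms] cinv_in[OF assms]
  by (force simp: image_iff)

text \<open>Inserting \<open>coord c'\<close> followed by \<open>cinv c'\<close> between the two
  maps changes nothing where \<open>\<phi>\<close> lands in \<open>cdom c'\<close>, an open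
  condition; the ordinary chain rule then applies near \<open>coord c p\<close>.\<close>

lemma jacobian_local_compose:
  assumes A: "complex_atlas A" and \<phi>: "holo_self_map A \<phi>" and \<psi>: "holo_self_map A \<psi>"
    and c: "c \<in> A" "c' \<in> A" "c'' \<in> A"
    and p: "p \<in> cdom c" "\<phi> p \<in> cdom c'" "\<psi> (\<phi> p) \<in> cdom c''"
  shows "jacobian (coord c'' \<circ> (\<psi> \<circ> \<phi>) \<circ> cinv c) (coord c p) =
    jacobian (coord c'' \<circ> \<psi> \<circ> cinv c') (coord c' (\<phi> p)) ** jacobian (coord c' \<circ> \<phi> \<circ> cinv c) (coord c p)"
proof -
  let ?F = "coord c' \<circ> \<phi> \<circ> cinv c" and ?G = "coord c'' \<circ> \<psi> \<circ> cinv c'"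
  let ?S = "local_dom c c' \<phi>" and ?T = "local_dom c' c'' \<psi>"
  have x: "coord c p \<in> ?S" "?F (coord c p) = coord c' (\<phi> p)" "coord c' (\<phi> p) \<in> ?T"
    using p by (auto simp: cinv_coord[OF A c(1)])
  have "jacobian (coord c'' \<circ> (\<psi> \<circ> \<phi>) \<circ> cinv c) (coord c p) = jacobian (\<lambda>y. ?G (?F y)) (coord c p)"
    by (rule jacobian_cong_open[OF open_local_dom[OF A \<phi> c(1,2)] x(1)])
      (auto simp: cinv_coord[OF A c(1)] cinv_coord[OF A c(2)])
  also have "\<dots> = jacobian ?G (?F (coord c p)) ** jacobian ?F (coord c p)"
    using x by (intro jacobian_compose[OF holo_self_map_local[OF \<phi> c(1,2)] _ holo_self_map_local[OF \<psi> c(2,3)]]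
        open_local_dom[OF A \<psi> c(2,3)]) auto
  finally show ?thesis
    by (simp only: x(2))
qed

lemma jacobian_local_id:
  assumes "complex_atlas A" "c \<in> A" "p \<in> cdom c"
  shows "jacobian (coord c \<circ> id \<circ> cinv c) (coord c p) = mat 1"
proof -
  have "jacobian (coord c \<circ> id \<circ> cinv c) (coord c p) = jacobian (\<lambda>y. y) (coord c p)"
    by (rule jacobian_cong_open[OF open_cimg[OF assms(1,2)] coord_in[OF assms]])
      (simp add: coord_cinv[OF assms(1,2)])
  then show ?thesis
    by (simp add: jacobian_id)
qed

lemma AutD:
  assumes "\<phi> \<in> Aut A"
  shows "bij \<phi>" "holo_self_map A \<phi>" "holo_self_map A (inv \<phi>)"
  using assms by (auto simp: Aut_def)

lemma inv_Aut: "\<phi> \<in> Aut A \<Longrightarrow> inv \<phi> \<in> Aut A"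
  by (auto simp: Aut_def bij_imp_bij_inv inv_inv_eq)

text \<open>The chain rule for \<open>inv \<phi> \<circ> \<phi> = id\<close>. Holomorphy of the
  inverse, part of \<open>Aut\<close>, thus supplies a left inverse of the Jacobian.\<close>

lemma jacobian_inv_Aut:
  assumes A: "complex_atlas A" and \<phi>: "\<phi> \<in> Aut A" and c: "c \<in> A" "c' \<in> A"
    and p: "p \<in> cdom c" "\<phi> p \<in> cdom c'"
  shows "jacobian (coord c \<circ> inv \<phi> \<circ> cinv c') (coord c' (\<phi> p)) **
    jacobian (coord c' \<circ> \<phi> \<circ> cinv c) (coord c p) = mat 1"
proof -
  have "inv \<phi> \<circ> \<phi> = id" "inv \<phi> (\<phi> p) = p"
    using AutD(1)[OF \<phi>] by (simp_all add: bij_def)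
  then show ?thesis
    using jacobian_local_compose[OF A AutD(2,3)[OF \<phi>] c(1,2,1) p] p(1) jacobian_local_id[OF A c(1) p(1)]
    by simp
qed

lemma invertible_jacobian_Aut:
  assumes "complex_atlas A" "\<phi> \<in> Aut A" "c \<in> A" "c' \<in> A" "p \<in> cdom c" "\<phi> p \<in> cdom c'"
  shows "invertible (jacobian (coord c' \<circ> \<phi> \<circ> cinv c) (coord c p))"
  unfolding invertible_left_inverse using jacobian_inv_Aut[OF assms] by blast

text \<open>Near each point one target chart suffices, and there the function is \<open>g\<close> in
  that chart after the smooth local expression of \<open>\<phi>\<close>; smoothness is
  local.\<close>

lemma smooth_fun_compose_holo:
  assumes A: "complex_atlas A" and g: "smooth_fun A g" and \<phi>: "holo_self_map A \<phi>"
  shows "smooth_fun A (g \<circ> \<phi>)"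
  unfolding smooth_fun_def
proof (intro ballI smooth_on_locally)
  fix c x assume c: "c \<in> A" and x: "x \<in> cimg c"
  define c' where "c' = chart_at A (\<phi> (cinv c x))"
  have c': "c' \<in> A" "\<phi> (cinv c x) \<in> cdom c'"
    by (simp_all add: c'_def chart_at_in[OF A])
  have o: "open (local_dom c c' \<phi>)"
    by (rule open_local_dom[OF A \<phi> c c'(1)])
  have F: "smooth_on (local_dom c c' \<phi>) (coord c' \<circ> \<phi> \<circ> cinv c)"
    using holo_self_map_local[OF \<phi> c c'(1)] by (simp add: holo_map_on_def)
  have "smooth_on (local_dom c c' \<phi>) (\<lambda>y. (g \<circ> cinv c') ((coord c' \<circ> \<phi> \<circ> cinv c) y))"
  proof (rule smooth_on_compose[OF o _ F])
    show "smooth_on (cimg c') (g \<circ> cinv c')"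
      using g c'(1) by (simp add: smooth_fun_def)
    show "(coord c' \<circ> \<phi> \<circ> cinv c) y \<in> cimg c'" if "y \<in> local_dom c c' \<phi>" for y
      using that by (auto simp: cinv_coord[OF A c] coord_in[OF A c'(1)])
  qed
  moreover have "(g \<circ> cinv c') ((coord c' \<circ> \<phi> \<circ> cinv c) y) = (g \<circ> \<phi> \<circ> cinv c) y"
    if "y \<in> local_dom c c' \<phi>" for y
    using that by (auto simp: cinv_coord[OF A c] cinv_coord[OF A c'(1)])
  ultimately have "smooth_on (local_dom c c' \<phi>) (g \<circ> \<phi> \<circ> cinv c)"
    by (rule smooth_on_cong[OF o, THEN iffD1, rotated])
  moreover have "x \<in> local_dom c c' \<phi>"
    using x c'(2) by (simp add: local_dom_iff[OF A c])
  ultimately show "\<exists>U. open U \<and> x \<in> U \<and> smooth_on U (g \<circ> \<phi> \<circ> cinv c)"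
    using o by blast
qed

section \<open>Pull-back and conformal change of metrics\<close>

lemma hermitian_form_eq:
  fixes H :: "complex^'n::finite^'n"
  shows "(\<Sum>i\<in>UNIV. \<Sum>j\<in>UNIV. H $ i $ j * v $ i * cnj (w $ j)) = (\<Sum>j\<in>UNIV. (v v* H) $ j * cnj (w $ j))"
  by (subst sum.swap) (simp add: vector_matrix_mult_def sum_distrib_left sum_distrib_right mult_ac)

text \<open>The pulled-back form at \<open>v\<close> is the original form at \<open>J *v v\<close>:
  the left factor of the congruence acts on \<open>v\<close>, and \<open>adj\<close> moves
  \<open>conj_matrix J\<close> onto the conjugated argument.\<close>

lemma hermitian_form_pull_matrix:
  fixes H J :: "complex^'n::finite^'n"
  shows "(\<Sum>i\<in>UNIV. \<Sum>j\<in>UNIV. pull_matrix J H $ i $ j * v $ i * cnj (v $ j)) =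
    (\<Sum>k\<in>UNIV. \<Sum>l\<in>UNIV. H $ k $ l * (J *v v) $ k * cnj ((J *v v) $ l))"
proof -
  have adj: "(\<Sum>j\<in>UNIV. (w v* conj_matrix J) $ j * cnj (v $ j)) = (\<Sum>l\<in>UNIV. w $ l * cnj ((J *v v) $ l))" for w
    unfolding vector_matrix_mult_def matrix_vector_mult_def conj_matrix_def
    by (simp add: sum_distrib_left sum_distrib_right mult_ac) (rule sum.swap)
  have "v v* pull_matrix J H = ((J *v v) v* H) v* conj_matrix J"
    by (simp add: pull_matrix_eq vector_matrix_mul_assoc[symmetric])
  then show ?thesis
    by (simp add: hermitian_form_eq adj)
qed

text \<open>On a vector in the kernel of \<open>transpose H\<close> the Hermitian form vanishes, so
  positivity forces that vector to be 0.\<close>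

lemma positive_hermitian_invertible:
  assumes "positive_hermitian H"
  shows "invertible H"
proof -
  have "v = 0" if "transpose H *v v = 0" for v
  proof (rule ccontr)
    assume "v \<noteq> 0"
    then have "0 < Re (\<Sum>i\<in>UNIV. \<Sum>j\<in>UNIV. H $ i $ j * v $ i * cnj (v $ j))"
      using assms unfolding positive_hermitian_def by blast
    moreover have "(\<Sum>i\<in>UNIV. \<Sum>j\<in>UNIV. H $ i $ j * v $ i * cnj (v $ j)) = 0"
      using that by (simp add: hermitian_form_eq)
    ultimately show False
      by simp
  qed
  then have "invertible (transpose H)"
    unfolding invertible_left_inverse matrix_left_invertible_ker by blast
  then show ?thesis
    by (simp add: invertible_det_nz)
qed

lemma positive_hermitian_pull_matrix:
  assumes H: "positive_hermitian H" and J: "invertible J"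
  shows "positive_hermitian (pull_matrix J H)"
  unfolding positive_hermitian_def
proof (intro conjI allI impI)
  show "pull_matrix J H $ j $ i = cnj (pull_matrix J H $ i $ j)" for i j
  proof -
    have "cnj (H $ k $ l) = H $ l $ k" for k l
      using H unfolding positive_hermitian_def by metis
    then have "cnj (pull_matrix J H $ i $ j) =
        (\<Sum>k\<in>UNIV. \<Sum>l\<in>UNIV. J $ l $ j * cnj (J $ k $ i) * H $ l $ k)"
      by (simp add: pull_matrix_def mult_ac)
    also have "\<dots> = pull_matrix J H $ j $ i"
      by (subst sum.swap) (simp add: pull_matrix_def)
    finally show ?thesis
      by simp
  qed
  fix v :: "complex^'a" assume "v \<noteq> 0"
  have Jv: "J *v v \<noteq> 0"
    using J \<open>v \<noteq> 0\<close> unfolding invertible_left_inverse matrix_left_invertible_ker by blast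
  show "0 < Re (\<Sum>i\<in>UNIV. \<Sum>j\<in>UNIV. pull_matrix J H $ i $ j * v $ i * cnj (v $ j))"
    unfolding hermitian_form_pull_matrix using H Jv unfolding positive_hermitian_def by blast
qed

lemma positive_hermitian_scaleR:
  assumes "positive_hermitian H" "r > 0"
  shows "positive_hermitian (r *\<^sub>R H)"
  unfolding positive_hermitian_def
proof (intro conjI allI impI)
  have "H $ j $ i = cnj (H $ i $ j)" for i j
    using assms(1) unfolding positive_hermitian_def by blast
  then show "(r *\<^sub>R H) $ j $ i = cnj ((r *\<^sub>R H) $ i $ j)" for i j
    by (metis complex_cnj_scaleR vector_scaleR_component)
  fix v :: "complex^'a" assume "v \<noteq> 0"
  then have "0 < r * Re (\<Sum>i\<in>UNIV. \<Sum>j\<in>UNIV. H $ i $ j * v $ i * cnj (v $ j))"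
    using assms unfolding positive_hermitian_def by (intro mult_pos_pos) blast+
  then show "0 < Re (\<Sum>i\<in>UNIV. \<Sum>j\<in>UNIV. (r *\<^sub>R H) $ i $ j * v $ i * cnj (v $ j))"
    by (simp flip: scaleR_right.sum)
qed

section \<open>Pull-backs of metrics along automorphisms\<close>

lemma hermitian_metricD:
  assumes "hermitian_metric A \<eta>" "c \<in> A"
  shows "smooth_on (cimg c) (\<eta> c)" "x \<in> cimg c \<Longrightarrow> positive_hermitian (\<eta> c x)"
    "c' \<in> A \<Longrightarrow> p \<in> cdom c \<Longrightarrow> p \<in> cdom c' \<Longrightarrow> \<eta> c (coord c p) =
       pull_matrix (jacobian (coord c' \<circ> cinv c) (coord c p)) (\<eta> c' (coord c' p))"
  using assms unfolding hermitian_metric_def by blast+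

lemma hermitian_metric_eq_0: "hermitian_metric A \<eta> \<Longrightarrow> c \<notin> A \<or> x \<notin> cimg c \<Longrightarrow> \<eta> c x = 0"
  unfolding hermitian_metric_def by blast

text \<open>The definition of \<open>pullback\<close> uses the chart selected by
  \<open>chart_at\<close>; here any chart around \<open>\<phi> p\<close> may be used. The
  transformation law of \<open>\<eta>\<close> changes the chart, and the chain rule with
  \<open>id\<close> as outer map absorbs the transition Jacobian.\<close>

lemma pullback_eq:
  assumes A: "complex_atlas A" and \<eta>: "hermitian_metric A \<eta>" and \<phi>: "holo_self_map A \<phi>"
    and c: "c \<in> A" "c' \<in> A" and p: "p \<in> cdom c" "\<phi> p \<in> cdom c'"
  shows "pullback A \<phi> \<eta> c (coord c p) =
    pull_matrix (jacobian (coord c' \<circ> \<phi> \<circ> cinv c) (coord c p)) (\<eta> c' (coord c' (\<phi> p)))"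
proof -
  define d where "d = chart_at A (\<phi> p)"
  have d: "d \<in> A" "\<phi> p \<in> cdom d"
    by (simp_all add: d_def chart_at_in[OF A])
  have "pullback A \<phi> \<eta> c (coord c p) =
      pull_matrix (jacobian (coord d \<circ> \<phi> \<circ> cinv c) (coord c p)) (\<eta> d (coord d (\<phi> p)))"
    using c p by (simp add: pullback_def Let_def coord_in[OF A c(1)] cinv_coord[OF A c(1)] d_def[symmetric] comp_def)
  also have "\<eta> d (coord d (\<phi> p)) =
      pull_matrix (jacobian (coord c' \<circ> id \<circ> cinv d) (coord d (\<phi> p))) (\<eta> c' (coord c' (\<phi> p)))"
    using hermitian_metricD(3)[OF \<eta> d(1) c(2) d(2) p(2)] by simp
  finally show ?thesis
    using jacobian_local_compose[OF A \<phi> holo_self_map_id[OF A] c(1) d(1) c(2) p(1) d(2)] p(2)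
    by (simp add: pull_matrix_mult comp_def)
qed

lemma smooth_on_pull_matrix:
  assumes "open S" "\<And>k i. smooth_on S (\<lambda>y. J y $ k $ i)" "\<And>k l. smooth_on S (\<lambda>y. H y $ k $ l)"
  shows "smooth_on S (\<lambda>y. pull_matrix (J y) (H y))"
proof (intro smooth_on_vec assms(1))
  show "smooth_on S (\<lambda>y. pull_matrix (J y) (H y) $ i $ j)" for i j
    unfolding pull_matrix_def vec_lambda_beta
    by (intro smooth_on_sum smooth_on_mult assms smooth_on_bounded_linear[OF bounded_linear_cnj])
qed

lemma smooth_on_pullback:
  assumes A: "complex_atlas A" and \<eta>: "hermitian_metric A \<eta>" and \<phi>: "holo_self_map A \<phi>"
    and c: "c \<in> A" "c' \<in> A"
  shows "smooth_on (local_dom c c' \<phi>) (pullback A \<phi> \<eta> c)"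
proof -
  let ?F = "coord c' \<circ> \<phi> \<circ> cinv c"
  note o = open_local_dom[OF A \<phi> c] and F = holo_self_map_local[OF \<phi> c]
  have "smooth_on (local_dom c c' \<phi>) (\<lambda>y. \<eta> c' (?F y))"
    by (rule smooth_on_compose[OF o _ _ hermitian_metricD(1)[OF \<eta> c(2)]])
      (use F in \<open>auto simp: holo_map_on_def comp_def cinv_coord[OF A c(1)] coord_in[OF A c(2)]\<close>)
  then have "smooth_on (local_dom c c' \<phi>) (\<lambda>y. pull_matrix (jacobian ?F y) (\<eta> c' (?F y)))"
    by (intro smooth_on_pull_matrix smooth_on_jacobian smooth_on_entry o F)
  then show ?thesis
    by (subst smooth_on_cong[OF o, where g="\<lambda>y. pull_matrix (jacobian ?F y) (\<eta> c' (?F y))"])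
      (auto simp: pullback_eq[OF A \<eta> \<phi> c] cinv_coord[OF A c(1)])
qed

lemma hermitian_metric_pullback:
  assumes A: "complex_atlas A" and \<eta>: "hermitian_metric A \<eta>" and \<phi>: "\<phi> \<in> Aut A"
  shows "hermitian_metric A (pullback A \<phi> \<eta>)"
  unfolding hermitian_metric_def
proof (intro conjI ballI allI impI)
  note hol = AutD(2)[OF \<phi>]
  fix c assume c: "c \<in> A"
  show "smooth_on (cimg c) (pullback A \<phi> \<eta> c)"
  proof (rule smooth_on_locally)
    fix x assume x: "x \<in> cimg c"
    let ?c' = "chart_at A (\<phi> (cinv c x))"
    have "x \<in> local_dom c ?c' \<phi>"
      using x by (simp add: local_dom_iff[OF A c] in_chart_at[OF A])
    then show "\<exists>U. open U \<and> x \<in> U \<and> smooth_on U (pullback A \<phi> \<eta> c)"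
      using open_local_dom[OF A hol c chart_at_in(1)[OF A]]
        smooth_on_pullback[OF A \<eta> hol c chart_at_in(1)[OF A]] by blast
  qed
  show "positive_hermitian (pullback A \<phi> \<eta> c x)" if x: "x \<in> cimg c" for x
  proof -
    let ?p = "cinv c x"
    let ?c' = "chart_at A (\<phi> ?p)"
    have p: "?p \<in> cdom c" "coord c ?p = x"
      using x by (simp_all add: cinv_in[OF A c] coord_cinv[OF A c])
    note c' = chart_at_in[OF A, of "\<phi> ?p"]
    have "positive_hermitian (pull_matrix (jacobian (coord ?c' \<circ> \<phi> \<circ> cinv c) (coord c ?p))
        (\<eta> ?c' (coord ?c' (\<phi> ?p))))"
      by (intro positive_hermitian_pull_matrix hermitian_metricD(2)[OF \<eta> c'(1)] coord_in[OF A c'(1)]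
          c'(2) invertible_jacobian_Aut[OF A \<phi> c c'(1) p(1)])
    then show ?thesis
      using pullback_eq[OF A \<eta> hol c c'(1) p(1) c'(2)] p(2) by simp
  qed
  show "pullback A \<phi> \<eta> c (coord c p) =
      pull_matrix (jacobian (coord d \<circ> cinv c) (coord c p)) (pullback A \<phi> \<eta> d (coord d p))"
    if d: "d \<in> A" and p: "p \<in> cdom c \<inter> cdom d" for d p
  proof -
    note c' = chart_at_in[OF A, of "\<phi> p"]
    have p': "p \<in> cdom c" "p \<in> cdom d"
      using p by auto
    show ?thesis
      \<comment> \<open>Both sides are expressed through the same target chart around
        \<open>\<phi> p\<close>; the chain rule for \<open>\<phi> \<circ> id\<close>, with
        \<open>id\<close> read from \<open>c\<close> to \<open>d\<close>, then relates them.\<close>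
      unfolding pullback_eq[OF A \<eta> hol c c'(1) p'(1) c'(2)] pullback_eq[OF A \<eta> hol d c'(1) p'(2) c'(2)]
      using jacobian_local_compose[OF A holo_self_map_id[OF A] hol c d c'(1) p'(1)] p' c'(2)
      by (simp add: pull_matrix_mult)
  qed
next
  show "pullback A \<phi> \<eta> c x = 0" if "c \<notin> A \<or> x \<notin> cimg c" for c x
    using that by (auto simp: pullback_def)
qed

text \<open>On charts this is functoriality of \<open>pull_matrix\<close>, as the Jacobians of
  \<open>inv \<phi>\<close> and \<open>\<phi>\<close> multiply to \<open>mat 1\<close>.\<close>

lemma pullback_pullback_inv:
  assumes A: "complex_atlas A" and \<eta>: "hermitian_metric A \<eta>" and \<phi>: "\<phi> \<in> Aut A"
  shows "pullback A \<phi> (pullback A (inv \<phi>) \<eta>) = \<eta>"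
proof (intro ext)
  fix c x
  show "pullback A \<phi> (pullback A (inv \<phi>) \<eta>) c x = \<eta> c x"
  proof (cases "c \<in> A \<and> x \<in> cimg c")
    case True
    then have c: "c \<in> A" and x: "x \<in> cimg c"
      by auto
    define p where "p = cinv c x"
    have p: "p \<in> cdom c" "x = coord c p"
      using x by (simp_all add: p_def cinv_in[OF A c] coord_cinv[OF A c])
    have "inv \<phi> (\<phi> p) = p"
      using AutD(1)[OF \<phi>] by (simp add: bij_def)
    note c' = chart_at_in[OF A, of "\<phi> p"]
    note hol = AutD(2,3)[OF \<phi>]
    let ?c' = "chart_at A (\<phi> p)"
    have "pullback A \<phi> (pullback A (inv \<phi>) \<eta>) c (coord c p) =
        pull_matrix (jacobian (coord ?c' \<circ> \<phi> \<circ> cinv c) (coord c p))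
          (pullback A (inv \<phi>) \<eta> ?c' (coord ?c' (\<phi> p)))"
      by (rule pullback_eq[OF A hermitian_metric_pullback[OF A \<eta> inv_Aut[OF \<phi>]] hol(1) c c'(1) p(1) c'(2)])
    also from \<open>inv \<phi> (\<phi> p) = p\<close> have "pullback A (inv \<phi>) \<eta> ?c' (coord ?c' (\<phi> p)) =
        pull_matrix (jacobian (coord c \<circ> inv \<phi> \<circ> cinv ?c') (coord ?c' (\<phi> p))) (\<eta> c (coord c p))"
      using pullback_eq[OF A \<eta> hol(2) c'(1) c c'(2)] p(1) by simp
    finally show ?thesis
      unfolding pull_matrix_mult[symmetric] jacobian_inv_Aut[OF A \<phi> c c'(1) p(1) c'(2)]
        pull_matrix_mat_1 p(2) .
  next
    \<comment> \<open>Off the charts both sides take the default value 0.\<close>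
    case False
    then show ?thesis
      using hermitian_metric_eq_0[OF \<eta>, of c x] by (auto simp: pullback_def)
  qed
qed

text \<open>The charts selected at \<open>p\<close> and at \<open>\<phi> p\<close> are joined by the
  local expression \<open>?F\<close>, whose Jacobian is invertible because \<open>\<phi>\<close> is
  an automorphism; the local invariance then applies.\<close>

lemma chern_scalar_pullback:
  assumes A: "complex_atlas A" and \<eta>: "hermitian_metric A \<eta>" and \<phi>: "\<phi> \<in> Aut A"
  shows "chern_scalar A (pullback A \<phi> \<eta>) p = chern_scalar A \<eta> (\<phi> p)"
proof -
  let ?c = "chart_at A p" and ?c' = "chart_at A (\<phi> p)"
  note hol = AutD(2)[OF \<phi>] and c = chart_at_in[OF A, of p] and c' = chart_at_in[OF A, of "\<phi> p"]
  let ?F = "coord ?c' \<circ> \<phi> \<circ> cinv ?c" and ?U = "local_dom ?c ?c' \<phi>"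
  have "chern_scalar_local (pullback A \<phi> \<eta> ?c) (coord ?c p) = chern_scalar_local (\<eta> ?c') (?F (coord ?c p))"
  proof (rule chern_scalar_local_pull_matrix[where U="?U" and V="cimg ?c'"])
    show "open ?U"
      by (rule open_local_dom[OF A hol c(1) c'(1)])
    show "coord ?c p \<in> ?U"
      using c c' by auto
    show "open (cimg ?c')"
      by (rule open_cimg[OF A c'(1)])
    show "?F y \<in> cimg ?c'" if "y \<in> ?U" for y
      using that by (auto simp: cinv_coord[OF A c(1)] coord_in[OF A c'(1)])
    show "holo_map_on ?U ?F"
      by (rule holo_self_map_local[OF hol c(1) c'(1)])
    show "invertible (jacobian ?F y)" if "y \<in> ?U" for y
      using that invertible_jacobian_Aut[OF A \<phi> c(1) c'(1)] by auto
    show "smooth_on (cimg ?c') (\<eta> ?c')"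
      by (rule hermitian_metricD(1)[OF \<eta> c'(1)])
    show "invertible (\<eta> ?c' z)" if "z \<in> cimg ?c'" for z
      by (rule positive_hermitian_invertible[OF hermitian_metricD(2)[OF \<eta> c'(1) that]])
    show "smooth_on ?U (pullback A \<phi> \<eta> ?c)"
      by (rule smooth_on_pullback[OF A \<eta> hol c(1) c'(1)])
    show "pullback A \<phi> \<eta> ?c y = pull_matrix (jacobian ?F y) (\<eta> ?c' (?F y))" if "y \<in> ?U" for y
      using that by (auto simp: pullback_eq[OF A \<eta> hol c(1) c'(1)] cinv_coord[OF A c(1)])
  qed
  then show ?thesis
    by (simp add: chern_scalar_def Let_def cinv_coord[OF A c(1)] c(2))
qed

section \<open>Conformal change of metrics\<close>

lemma hermitian_metric_conformal_change:
  assumes A: "complex_atlas A" and \<omega>: "hermitian_metric A \<omega>" and u: "smooth_fun A u"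
  shows "hermitian_metric A (conformal_change u (\<omega> :: ('m::t2_space, 'n::finite) metric))"
  unfolding hermitian_metric_def
proof (intro conjI ballI allI impI)
  fix c assume c: "c \<in> A"
  have "smooth_on (cimg c) (\<lambda>x. u (cinv c x))"
    using u c unfolding smooth_fun_def comp_def by blast
  then have "smooth_on (cimg c) (\<lambda>x. (2 / CARD('n)) * u (cinv c x))"
    by (intro smooth_on_mult smooth_on_const open_cimg[OF A c])
  then have "smooth_on (cimg c) (\<lambda>x. 2 * u (cinv c x) / CARD('n))"
    by (simp add: mult.commute)
  then show "smooth_on (cimg c) (conformal_change u \<omega> c)"
    unfolding conformal_change_def
    by (intro smooth_on_scaleR smooth_on_exp open_cimg[OF A c] hermitian_metricD(1)[OF \<omega> c])
  show "positive_hermitian (conformal_change u \<omega> c x)" if x: "x \<in> cimg c" for x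
  proof -
    have "conformal_change u \<omega> c x = exp (2 * u (cinv c x) / CARD('n)) *\<^sub>R \<omega> c x"
      by (simp add: conformal_change_def)
    then show ?thesis
      using positive_hermitian_scaleR[OF hermitian_metricD(2)[OF \<omega> c x]] by simp
  qed
  show "conformal_change u \<omega> c (coord c p) =
      pull_matrix (jacobian (coord d \<circ> cinv c) (coord c p)) (conformal_change u \<omega> d (coord d p))"
    if d: "d \<in> A" and p: "p \<in> cdom c \<inter> cdom d" for d p
  proof -
    have "pull_matrix J (r *\<^sub>R H) = r *\<^sub>R pull_matrix J H" for J H :: "complex^'n^'n" and r
      by (simp add: pull_matrix_def vec_eq_iff scaleR_right.sum)
    then show ?thesis
      using p hermitian_metricD(3)[OF \<omega> c d]
      by (simp add: conformal_change_def cinv_coord[OF A c] cinv_coord[OF A d])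
  qed
next
  show "conformal_change u \<omega> c x = 0" if "c \<notin> A \<or> x \<notin> cimg c" for c x
    using that hermitian_metric_eq_0[OF \<omega>] by (simp add: conformal_change_def)
qed

text \<open>The local formula is used with the exponent \<open>2 * u / n\<close>: its factor
  \<open>n\<close> cancels the denominator, and the remaining \<open>- 2\<close> is exactly the
  normalisation of \<open>chern_laplacian\<close>.\<close>

lemma chern_scalar_conformal_change:
  fixes \<omega> :: "('m::t2_space, 'n::finite) metric"
  assumes A: "complex_atlas A" and \<omega>: "hermitian_metric A \<omega>" and u: "smooth_fun A u"
  shows "chern_scalar A (conformal_change u \<omega>) p =
    exp (- (2 * u p / CARD('n))) * (chern_scalar A \<omega> p + chern_laplacian A \<omega> u p)"
proof -
  let ?c = "chart_at A p"
  note c = chart_at_in[OF A, of p]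
  let ?x = "coord ?c p"
  let ?f = "\<lambda>y. 2 * u (cinv ?c y) / CARD('n)"
  note o = open_cimg[OF A c(1)] and x = coord_in[OF A c]
  have u': "smooth_on (cimg ?c) (\<lambda>y. u (cinv ?c y))"
    using u c(1) unfolding smooth_fun_def comp_def by blast
  then have "smooth_on (cimg ?c) (\<lambda>y. (2 / CARD('n)) * u (cinv ?c y))"
    by (intro smooth_on_mult smooth_on_const o)
  then have f: "smooth_on (cimg ?c) ?f"
    by (simp add: mult.commute)
  \<comment> \<open>The constant is pulled through both operators; for the inner one this is done on
    the whole chart image, since the outer one differentiates the result.\<close>
  have dd: "dz i (dzbar j (\<lambda>y. of_real (?f y))) ?x =
      (2 / of_nat CARD('n)) * dz i (dzbar j (\<lambda>y. of_real (u (cinv ?c y)))) ?x" for i j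
  proof -
    have uc: "smooth_on (cimg ?c) (\<lambda>y. complex_of_real (u (cinv ?c y)))"
      by (rule smooth_on_bounded_linear[OF bounded_linear_of_real o u'])
    have "dzbar j (\<lambda>y. of_real (?f y)) y =
        (2 / of_nat CARD('n)) * dzbar j (\<lambda>y. of_real (u (cinv ?c y))) y" if "y \<in> cimg ?c" for y
      using dzbar_mult[of "\<lambda>y. 2 / of_nat CARD('n)" y "\<lambda>y. of_real (u (cinv ?c y))" j]
        smooth_on_imp_differentiable[OF uc that] by (simp add: mult.commute)
    then have "dz i (dzbar j (\<lambda>y. of_real (?f y))) ?x =
        dz i (\<lambda>y. (2 / of_nat CARD('n)) * dzbar j (\<lambda>y. of_real (u (cinv ?c y))) y) ?x"
      by (rule dz_cong_open[OF o x])
    also have "\<dots> = (2 / of_nat CARD('n)) * dz i (dzbar j (\<lambda>y. of_real (u (cinv ?c y)))) ?x"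
      using dz_mult(1)[of "\<lambda>y. 2 / of_nat CARD('n)" ?x "dzbar j (\<lambda>y. of_real (u (cinv ?c y)))" i]
        smooth_on_imp_differentiable[OF smooth_on_dzbar[OF o uc] x] by simp
    finally show ?thesis .
  qed
  have "chern_scalar_local (conformal_change u \<omega> ?c) ?x =
    exp (- ?f ?x) *\<^sub>R (chern_scalar_local (\<omega> ?c) ?x - of_nat CARD('n) *
      (\<Sum>i\<in>UNIV. \<Sum>j\<in>UNIV. upper (\<omega> ?c ?x) i j * dz i (dzbar j (\<lambda>y. of_real (?f y))) ?x))"
    unfolding conformal_change_def
    by (rule chern_scalar_local_conformal[OF o x f hermitian_metricD(1)[OF \<omega> c(1)]])
      (rule positive_hermitian_invertible[OF hermitian_metricD(2)[OF \<omega> c(1)]])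
  also have "\<dots> = exp (- ?f ?x) *\<^sub>R (chern_scalar_local (\<omega> ?c) ?x +
      (- 2 * (\<Sum>i\<in>UNIV. \<Sum>j\<in>UNIV. upper (\<omega> ?c ?x) i j * dz i (dzbar j (\<lambda>y. of_real (u (cinv ?c y)))) ?x)))"
    unfolding dd by (simp add: sum_distrib_left sum_negf mult_ac)
  finally show ?thesis
    by (simp add: chern_scalar_def chern_laplacian_def Let_def cinv_coord[OF A c])
qed

section \<open>Realising \<open>g\<close> as a Chern scalar curvature\<close>

theorem proposition2p10:
  fixes A :: "('m::t2_space, 'n::finite) chart set"
    and \<omega> :: "('m, 'n) metric"
    and f\<^sub>0 g :: "'m \<Rightarrow> real"
    and c :: "('m \<Rightarrow> real) \<Rightarrow> ereal"
  assumes "complex_atlas A"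
    and "compact (UNIV :: 'm set)"
    and "connected (UNIV :: 'm set)"
    and "CARD('n) \<ge> 2"
    and "hermitian_metric A \<omega>"
    and "\<And>p. chern_scalar A \<omega> p = gauduchon_degree A \<omega>"
    and "gauduchon_degree A \<omega> < 0"
    and "f\<^sub>0 = eccentricity A \<omega>"
    and "\<And>f. smooth_fun A f \<Longrightarrow> integral_vol A \<omega> (\<lambda>p. f p * f\<^sub>0 p) < 0
           \<Longrightarrow> threshold_constant A \<omega> f (c f)"
    and "smooth_fun A g"
    and "\<exists>p. g p < 0"
    and "\<exists>\<phi>\<in>Aut A. integral_vol A \<omega> (\<lambda>p. (g \<circ> \<phi>) p * f\<^sub>0 p) < 0
           \<and> c (g \<circ> \<phi>) < ereal (gauduchon_degree A \<omega>)"
  shows "\<exists>\<omega>\<^sub>1. hermitian_metric A \<omega>\<^sub>1 \<and> conformally_equivalent A \<omega>\<^sub>1 \<omega>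
           \<and> (\<forall>p. chern_scalar A \<omega>\<^sub>1 p = g p)"
proof -
  note A = assms(1) and \<omega> = assms(5)
  obtain \<phi> where \<phi>: "\<phi> \<in> Aut A" and int: "integral_vol A \<omega> (\<lambda>p. (g \<circ> \<phi>) p * f\<^sub>0 p) < 0"
    and less: "c (g \<circ> \<phi>) < ereal (gauduchon_degree A \<omega>)"
    using assms(12) by blast
  have "smooth_fun A (g \<circ> \<phi>)"
    by (rule smooth_fun_compose_holo[OF A assms(10) AutD(2)[OF \<phi>]])
  then have "threshold_constant A \<omega> (g \<circ> \<phi>) (c (g \<circ> \<phi>))"
    using int by (rule assms(9))
  \<comment> \<open>The Gauduchon degree lies between \<open>c (g \<circ> \<phi>)\<close> and 0 by
    the choice of \<open>\<phi>\<close> and by its negativity, so it is an admissible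
    constant.\<close>
  then have "chern_equation_solvable A \<omega> (gauduchon_degree A \<omega>) (g \<circ> \<phi>)"
    using less assms(7) by (auto simp: threshold_constant_def)
  then obtain u where u: "smooth_fun A u" and eq: "\<And>p. chern_laplacian A \<omega> u p + gauduchon_degree A \<omega>
      - (g \<circ> \<phi>) p * exp (2 * u p / CARD('n)) = 0"
    unfolding chern_equation_solvable_def by blast
  define \<eta> where "\<eta> = conformal_change u \<omega>"
  have \<eta>: "hermitian_metric A \<eta>"
    unfolding \<eta>_def by (rule hermitian_metric_conformal_change[OF A \<omega> u])
  have scal: "chern_scalar A \<eta> p = g (\<phi> p)" for p
  proof -
    \<comment> \<open>As the curvature of \<open>\<omega>\<close> is the constant Gauduchon degree,
      the equation for \<open>u\<close> says precisely this; the exponential then cancels the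
      conformal factor.\<close>
    have "chern_scalar A \<omega> p + chern_laplacian A \<omega> u p = g (\<phi> p) * exp (2 * u p / CARD('n))"
      using eq[of p] assms(6)[of p] by simp
    then show ?thesis
      by (simp add: \<eta>_def chern_scalar_conformal_change[OF A \<omega> u] exp_minus)
  qed
  \<comment> \<open>The curvature of \<open>\<eta>\<close> is \<open>g \<circ> \<phi>\<close>.
    Pulling back along \<open>inv \<phi>\<close> turns it into \<open>g\<close>, while pulling back
    again along \<open>\<phi>\<close> returns \<open>\<eta>\<close>, a member of the conformal class
    of \<open>\<omega>\<close>.\<close>
  let ?\<omega>\<^sub>1 = "pullback A (inv \<phi>) \<eta>"
  have "hermitian_metric A ?\<omega>\<^sub>1"
    by (rule hermitian_metric_pullback[OF A \<eta> inv_Aut[OF \<phi>]])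
  moreover have "pullback A \<phi> ?\<omega>\<^sub>1 \<in> conformal_class A \<omega>"
    unfolding pullback_pullback_inv[OF A \<eta> \<phi>] using u by (auto simp: \<eta>_def conformal_class_def)
  then have "conformally_equivalent A ?\<omega>\<^sub>1 \<omega>"
    using \<phi> by (auto simp: conformally_equivalent_def)
  moreover have "chern_scalar A ?\<omega>\<^sub>1 p = g p" for p
    using AutD(1)[OF \<phi>]
    by (simp add: chern_scalar_pullback[OF A \<eta> inv_Aut[OF \<phi>]] scal bij_is_surj surj_f_inv_f)
  ultimately show ?thesis
    by blast
qed

end
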